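(* Let $v$ be a $C^{1,1}$ vector field on a neighbourhood of $\overline\Omega$ with flow $T_t$, and put $S=v$, $R=(v\cdot\nabla)v$. Let $k\ge1$ be such that $\lambda_{k-1}(0)<\lambda_k(0)<\lambda_{k+1}(0)$ (with $\lambda_0(0)=-\infty$), let $\phi=u_k(0)$, and put $\dot A=\dot A_0(\phi,\phi)$, $\ddot A=\ddot A_0(\phi,\phi)$, $\dot B=\dot B_0(\phi,\phi)$, $\ddot B=\ddot B_0(\phi,\phi)$. If $\nabla\cdot v=0$ everywhere, then $\dot B=\ddot B=0$ and $$\dot A=-\int_\Omega(DS^T+DS)[\nabla\phi,\nabla\phi]\,dx,$$ $$\ddot A=\int_\Omega\Bigl((2(DS)^2-DR)^T+(2(DS)^2-DR)+2(DS)(DS)^T\Bigr)[\nabla\phi,\nabla\phi]\,dx.$$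
   Context: $\Omega\subset\mathbb{R}^n$, $n\ge2$, is a bounded Lipschitz domain whose boundary is divided into disjoint relatively open sets $\gamma_0,\gamma_1$ with $\overline{\gamma_0}\cup\overline{\gamma_1}=\partial\Omega$ and $\overline{\gamma_0}\cap\overline{\gamma_1}=\emptyset$. Let $X=L^2(\Omega)$ and $V=\{w\in H^1(\Omega): w|_{\gamma_0}=0\}$ (trace sense). Dynamical deformation: for $|t|\ll1$, $T_t:\Omega\to\Omega_t=T_t(\Omega)$ is defined by $T_tx=X(t)$, where $X(\cdot)$ solves $dX/dt=v(X)$, $X(0)=x$. Put $a_t=\det DT_t$ and $Q_t=(DT_t)^{-1}\bigl((DT_t)^{-1}\bigr)^T$, $DT_t$ being the Jacobi matrix, and $$A_t(u,w)=\int_\Omega Q_t[\nabla u,\nabla w]\,a_t\,dx\ (u,w\in V),\qquad B_t(u,w)=\int_\Omega uw\,a_t\,dx\ (u,w\in X).$$ At $t=0$ set $$\dot A_0(u,w)=\int_\Omega\partial_t\bigl(Q_t[\nabla u,\nabla w]a_t\bigr)\big|_{t=0}dx,\quad \ddot A_0(u,w)=\int_\Omega\partial_t^2\bigl(Q_t[\nabla u,\nabla w]a_t\bigr)\big|_{t=0}dx,$$ $$\dot B_0(u,w)=\int_\Omega uw\,\partial_ta_t|_{t=0}\,dx,\quad \ddot B_0(u,w)=\int_\Omega uw\,\partial_t^2a_t|_{t=0}\,dx,$$ with $t$-derivatives taken for (almost every) fixed $x\in\Omega$. $\lambda_1(t)\le\lambda_2(t)\le\cdots$ are the eigenvalues (with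 multiplicity) of: $u\in V$, $B_t(u,u)=1$, $A_t(u,w)=\lambda B_t(u,w)$ for all $w\in V$, with $B_t$-orthonormal eigenfunctions $u_1(t),u_2(t),\dots$. Notation: $G[\xi,\eta]=\xi^TG\eta$ for a matrix $G$; $DS=(\partial S^i/\partial x_j)_{ij}$ and $DR$ are Jacobi matrices (defined almost everywhere for $R$); $DS^T$ is the transpose of $DS$. *)

theory Defs
  imports "HOL-Analysis.Analysis"
begin

text \<open>Near each boundary point, after a rigid motion with vertical direction \<open>e\<close>, the domain
  is the part above the graph of a Lipschitz function \<open>g\<close> on the hyperplane orthogonal to \<open>e\<close>.\<close>

definition lipschitz_boundary :: "(real^'n) set \<Rightarrow> bool" where
  "lipschitz_boundary \<Omega> \<longleftrightarrow>
     (\<forall>p\<in>frontier \<Omega>. \<exists>r>0. \<exists>e. \<exists>g :: real^'n \<Rightarrow> real. \<exists>L.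
        norm e = 1 \<and> L-lipschitz_on {y. y \<bullet> e = 0} g \<and>
        \<Omega> \<inter> ball p r = {x \<in> ball p r. x \<bullet> e > g (x - (x \<bullet> e) *\<^sub>R e)})"

definition bounded_lipschitz_domain :: "(real^'n) set \<Rightarrow> bool" where
  "bounded_lipschitz_domain \<Omega> \<longleftrightarrow>
     open \<Omega> \<and> connected \<Omega> \<and> \<Omega> \<noteq> {} \<and> bounded \<Omega> \<and> lipschitz_boundary \<Omega>"

text \<open>The \<open>s\<close>-dimensional Hausdorff measure for integer \<open>s \<ge> 1\<close>, normalised so that it agrees
  with \<open>s\<close>-dimensional area.  Boundedness of the covering sets is required because
  \<^const>\<open>diameter\<close> is not meaningful on unbounded sets.\<close>

definition hausdorff_pre :: "nat \<Rightarrow> real \<Rightarrow> 'a::metric_space set \<Rightarrow> ennreal" where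
  "hausdorff_pre s \<delta> A =
     (INF C \<in> {C :: nat \<Rightarrow> 'a set. A \<subseteq> (\<Union>i. C i) \<and> (\<forall>i. bounded (C i) \<and> diameter (C i) \<le> \<delta>)}.
        (\<Sum>i. ennreal (unit_ball_vol (real s) * (diameter (C i) / 2) ^ s)))"

definition hausdorff_measure :: "nat \<Rightarrow> 'a::metric_space measure" where
  "hausdorff_measure s = measure_of UNIV (sets borel) (\<lambda>A. SUP \<delta>\<in>{0<..}. hausdorff_pre s \<delta> A)"

definition surface_measure :: "(real^'n) set \<Rightarrow> (real^'n) measure" where
  "surface_measure \<Omega> = restrict_space (hausdorff_measure (CARD('n) - 1)) (frontier \<Omega>)"

definition partial :: "'n \<Rightarrow> (real^'n \<Rightarrow> real) \<Rightarrow> real^'n \<Rightarrow> real" where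
  "partial i f x = frechet_derivative f (at x) (axis i 1)"

primrec C_k :: "nat \<Rightarrow> (real^'n \<Rightarrow> real) \<Rightarrow> bool" where
  "C_k 0 f \<longleftrightarrow> continuous_on UNIV f"
| "C_k (Suc k) f \<longleftrightarrow> (\<forall>x. f differentiable (at x)) \<and> (\<forall>i. C_k k (partial i f))"

definition smooth :: "(real^'n \<Rightarrow> real) \<Rightarrow> bool" where
  "smooth f \<longleftrightarrow> (\<forall>k. C_k k f)"

definition test_function :: "(real^'n) set \<Rightarrow> (real^'n \<Rightarrow> real) \<Rightarrow> bool" where
  "test_function \<Omega> \<psi> \<longleftrightarrow> smooth \<psi> \<and> (\<exists>K. compact K \<and> K \<subseteq> \<Omega> \<and> (\<forall>x. x \<notin> K \<longrightarrow> \<psi> x = 0))"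

definition L2 :: "'a measure \<Rightarrow> ('a \<Rightarrow> real) set" where
  "L2 M = {f \<in> borel_measurable M. integrable M (\<lambda>x. (f x)\<^sup>2)}"

definition has_weak_gradient ::
    "(real^'n) set \<Rightarrow> (real^'n \<Rightarrow> real) \<Rightarrow> (real^'n \<Rightarrow> real^'n) \<Rightarrow> bool" where
  "has_weak_gradient \<Omega> u g \<longleftrightarrow>
     (\<forall>i. (\<lambda>x. g x $ i) \<in> L2 (lebesgue_on \<Omega>)) \<and>
     (\<forall>\<psi> i. test_function \<Omega> \<psi> \<longrightarrow>
        (LINT x|lebesgue_on \<Omega>. u x * partial i \<psi> x) = - (LINT x|lebesgue_on \<Omega>. g x $ i * \<psi> x))"

text \<open>The weak gradient is unique up to null sets; elements of function spaces are represented by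
  functions on the whole space whose values outside \<open>\<Omega>\<close> are irrelevant.\<close>

definition weak_grad :: "(real^'n) set \<Rightarrow> (real^'n \<Rightarrow> real) \<Rightarrow> real^'n \<Rightarrow> real^'n" where
  "weak_grad \<Omega> u = (SOME g. has_weak_gradient \<Omega> u g)"

definition H1 :: "(real^'n) set \<Rightarrow> (real^'n \<Rightarrow> real) set" where
  "H1 \<Omega> = {u \<in> L2 (lebesgue_on \<Omega>). \<exists>g. has_weak_gradient \<Omega> u g}"

definition H1_norm :: "(real^'n) set \<Rightarrow> (real^'n \<Rightarrow> real) \<Rightarrow> real" where
  "H1_norm \<Omega> u =
     sqrt ((LINT x|lebesgue_on \<Omega>. (u x)\<^sup>2) + (LINT x|lebesgue_on \<Omega>. (norm (weak_grad \<Omega> u x))\<^sup>2))"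

text \<open>The trace operator is the continuous extension to \<open>H\<^sup>1(\<Omega>)\<close>, with values in
  \<open>L\<^sup>2(\<partial>\<Omega>)\<close>, of the restriction to the boundary of functions smooth up to the boundary.\<close>

definition has_trace :: "(real^'n) set \<Rightarrow> (real^'n \<Rightarrow> real) \<Rightarrow> (real^'n \<Rightarrow> real) \<Rightarrow> bool" where
  "has_trace \<Omega> w h \<longleftrightarrow>
     h \<in> L2 (surface_measure \<Omega>) \<and>
     (\<exists>f :: nat \<Rightarrow> real^'n \<Rightarrow> real.
        (\<forall>m. smooth (f m)) \<and>
        (\<lambda>m. H1_norm \<Omega> (\<lambda>x. f m x - w x)) \<longlonglongrightarrow> 0 \<and>
        (\<lambda>m. LINT x|surface_measure \<Omega>. (f m x - h x)\<^sup>2) \<longlonglongrightarrow> 0)"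

definition V_space :: "(real^'n) set \<Rightarrow> (real^'n) set \<Rightarrow> (real^'n \<Rightarrow> real) set" where
  "V_space \<Omega> \<gamma>0 =
     {w \<in> H1 \<Omega>. \<exists>h. has_trace \<Omega> w h \<and> (AE x in surface_measure \<Omega>. x \<in> \<gamma>0 \<longrightarrow> h x = 0)}"

definition C11_on :: "(real^'n) set \<Rightarrow> (real^'n \<Rightarrow> real^'n) \<Rightarrow> bool" where
  "C11_on U v \<longleftrightarrow>
     (\<forall>x\<in>U. v differentiable (at x)) \<and> (\<exists>L. L-lipschitz_on U (\<lambda>x. jacobian v (at x)))"

definition divergence :: "(real^'n \<Rightarrow> real^'n) \<Rightarrow> real^'n \<Rightarrow> real" where
  "divergence v x = (\<Sum>i\<in>UNIV. jacobian v (at x) $ i $ i)"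

text \<open>\<open>(v \<cdot> \<nabla>) v\<close>, whose \<open>i\<close>-th component is the sum over \<open>j\<close> of \<open>v\<^sub>j \<partial>\<^sub>j v\<^sub>i\<close>.\<close>

definition advection :: "(real^'n \<Rightarrow> real^'n) \<Rightarrow> real^'n \<Rightarrow> real^'n" where
  "advection v x = (\<chi> i. \<Sum>j\<in>UNIV. v x $ j * jacobian v (at x) $ i $ j)"

definition is_flow ::
    "(real^'n) set \<Rightarrow> (real^'n \<Rightarrow> real^'n) \<Rightarrow> (real^'n) set \<Rightarrow> real \<Rightarrow> (real \<Rightarrow> real^'n \<Rightarrow> real^'n) \<Rightarrow> bool"
  where
  "is_flow U v \<Omega> \<epsilon> T \<longleftrightarrow>
     (\<forall>x\<in>\<Omega>. T 0 x = x \<and>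
        (\<forall>t. \<bar>t\<bar> < \<epsilon> \<longrightarrow> T t x \<in> U \<and> ((\<lambda>s. T s x) has_vector_derivative v (T t x)) (at t)))"

definition qform :: "real^'n^'n \<Rightarrow> real^'n \<Rightarrow> real^'n \<Rightarrow> real" where
  "qform G \<xi> \<eta> = \<xi> \<bullet> (G *v \<eta>)"

definition a_coeff :: "(real \<Rightarrow> real^'n \<Rightarrow> real^'n) \<Rightarrow> real \<Rightarrow> real^'n \<Rightarrow> real" where
  "a_coeff T t x = det (jacobian (T t) (at x))"

definition Q_coeff :: "(real \<Rightarrow> real^'n \<Rightarrow> real^'n) \<Rightarrow> real \<Rightarrow> real^'n \<Rightarrow> real^'n^'n" where
  "Q_coeff T t x =
     matrix_inv (jacobian (T t) (at x)) ** transpose (matrix_inv (jacobian (T t) (at x)))"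

definition A_integrand ::
    "(real^'n) set \<Rightarrow> (real \<Rightarrow> real^'n \<Rightarrow> real^'n) \<Rightarrow> (real^'n \<Rightarrow> real) \<Rightarrow> (real^'n \<Rightarrow> real)
      \<Rightarrow> real \<Rightarrow> real^'n \<Rightarrow> real" where
  "A_integrand \<Omega> T u w t x =
     qform (Q_coeff T t x) (weak_grad \<Omega> u x) (weak_grad \<Omega> w x) * a_coeff T t x"

definition A_form ::
    "(real^'n) set \<Rightarrow> (real \<Rightarrow> real^'n \<Rightarrow> real^'n) \<Rightarrow> real \<Rightarrow> (real^'n \<Rightarrow> real) \<Rightarrow> (real^'n \<Rightarrow> real) \<Rightarrow> real"
  where
  "A_form \<Omega> T t u w = (LINT x|lebesgue_on \<Omega>. A_integrand \<Omega> T u w t x)"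

definition B_form ::
    "(real^'n) set \<Rightarrow> (real \<Rightarrow> real^'n \<Rightarrow> real^'n) \<Rightarrow> real \<Rightarrow> (real^'n \<Rightarrow> real) \<Rightarrow> (real^'n \<Rightarrow> real) \<Rightarrow> real"
  where
  "B_form \<Omega> T t u w = (LINT x|lebesgue_on \<Omega>. u x * w x * a_coeff T t x)"

definition A_dot0 ::
    "(real^'n) set \<Rightarrow> (real \<Rightarrow> real^'n \<Rightarrow> real^'n) \<Rightarrow> (real^'n \<Rightarrow> real) \<Rightarrow> (real^'n \<Rightarrow> real) \<Rightarrow> real"
  where
  "A_dot0 \<Omega> T u w = (LINT x|lebesgue_on \<Omega>. deriv (\<lambda>t. A_integrand \<Omega> T u w t x) 0)"

definition A_ddot0 ::
    "(real^'n) set \<Rightarrow> (real \<Rightarrow> real^'n \<Rightarrow> real^'n) \<Rightarrow> (real^'n \<Rightarrow> real) \<Rightarrow> (real^'n \<Rightarrow> real) \<Rightarrow> real"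
  where
  "A_ddot0 \<Omega> T u w = (LINT x|lebesgue_on \<Omega>. (deriv ^^ 2) (\<lambda>t. A_integrand \<Omega> T u w t x) 0)"

definition B_dot0 ::
    "(real^'n) set \<Rightarrow> (real \<Rightarrow> real^'n \<Rightarrow> real^'n) \<Rightarrow> (real^'n \<Rightarrow> real) \<Rightarrow> (real^'n \<Rightarrow> real) \<Rightarrow> real"
  where
  "B_dot0 \<Omega> T u w = (LINT x|lebesgue_on \<Omega>. u x * w x * deriv (\<lambda>t. a_coeff T t x) 0)"

definition B_ddot0 ::
    "(real^'n) set \<Rightarrow> (real \<Rightarrow> real^'n \<Rightarrow> real^'n) \<Rightarrow> (real^'n \<Rightarrow> real) \<Rightarrow> (real^'n \<Rightarrow> real) \<Rightarrow> real"
  where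
  "B_ddot0 \<Omega> T u w = (LINT x|lebesgue_on \<Omega>. u x * w x * (deriv ^^ 2) (\<lambda>t. a_coeff T t x) 0)"

text \<open>\<open>lam 1 \<le> lam 2 \<le> \<dots>\<close> are the eigenvalues, listed with multiplicity, with corresponding
  \<open>B\<^sub>t\<close>-orthonormal eigenfunctions \<open>u 1, u 2, \<dots>\<close>.  The last clause says that nothing is missing
  from the list: each eigenspace is spanned by the listed eigenfunctions for that eigenvalue.
  The index 0 is not used.\<close>

definition eigensystem ::
    "(real^'n) set \<Rightarrow> (real^'n) set \<Rightarrow> (real \<Rightarrow> real^'n \<Rightarrow> real^'n) \<Rightarrow> real
      \<Rightarrow> (nat \<Rightarrow> real) \<Rightarrow> (nat \<Rightarrow> real^'n \<Rightarrow> real) \<Rightarrow> bool" where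
  "eigensystem \<Omega> \<gamma>0 T t lam u \<longleftrightarrow>
     (\<forall>i\<ge>1. \<forall>j\<ge>i. lam i \<le> lam j) \<and>
     (\<forall>j\<ge>1. u j \<in> V_space \<Omega> \<gamma>0 \<and>
        (\<forall>w \<in> V_space \<Omega> \<gamma>0. A_form \<Omega> T t (u j) w = lam j * B_form \<Omega> T t (u j) w)) \<and>
     (\<forall>i\<ge>1. \<forall>j\<ge>1. B_form \<Omega> T t (u i) (u j) = (if i = j then 1 else 0)) \<and>
     (\<forall>\<mu>. \<forall>z \<in> V_space \<Omega> \<gamma>0.
        (\<forall>w \<in> V_space \<Omega> \<gamma>0. A_form \<Omega> T t z w = \<mu> * B_form \<Omega> T t z w) \<longrightarrow>
        (\<exists>J c. finite J \<and> J \<subseteq> {j. 1 \<le> j \<and> lam j = \<mu>} \<and>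
           (AE x in lebesgue_on \<Omega>. z x = (\<Sum>j\<in>J. c j * u j x))))"

end

theory Submission
  imports Defs
begin

text \<open>Only the behaviour of the flow near a fixed point \<open>x\<close> and for small \<open>t\<close> matters. Write
  \<open>A(t) = Dv(T\<^sub>t x)\<close>. The Jacobi matrix \<open>J\<^sub>t = DT\<^sub>t(x)\<close> solves the linearised equation
  \<open>J' = A J\<close>, \<open>J\<^sub>0 = 1\<close> (\<open>flow_jacobian_short_time\<close>). By Jacobi's formula
  (\<open>det_has_derivative_linear_ode\<close>) the determinant grows at the rate \<open>div v = 0\<close>, so \<open>a\<^sub>t = 1\<close>
  near \<open>t = 0\<close> and the derivatives of \<open>B\<^sub>t\<close> vanish.

  For a fixed vector \<open>g\<close>, here the weak gradient at \<open>x\<close>, the vector \<open>p\<^sub>t = J\<^sub>t\<^sup>-\<^sup>T g\<close> solves the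
  adjoint equation \<open>p' = - A\<^sup>T p\<close>, and \<open>Q\<^sub>t[g, g] a\<^sub>t = \<bar>p\<^sub>t\<bar>\<^sup>2\<close> (\<open>flow_coefficients\<close>). Hence the first
  derivative of the integrand is \<open>- 2 (A p) \<bullet> p\<close>, which at \<open>t = 0\<close> is the first formula. No inverse
  matrix is ever differentiated.

  A second differentiation requires \<open>A'(0)\<close>. The map \<open>Dv\<close> is merely Lipschitz, but by Rademacher's
  theorem (\<open>rademacher\<close>) it is differentiable at almost every \<open>x\<close>, and there \<open>A'(0)\<close> is the
  derivative \<open>E\<close> of \<open>Dv\<close> in direction \<open>v\<close>. At such a point second derivatives are symmetric
  (\<open>symmetric_second_derivative\<close>), so differentiating \<open>R = Dv v\<close> gives \<open>DR = (Dv)\<^sup>2 + E\<close>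
  (\<open>jacobian_advection\<close>). Replacing \<open>E\<close> by \<open>DR - (Dv)\<^sup>2\<close> yields the second formula pointwise almost
  everywhere, which determines the integral.

  Rademacher's theorem rests on the one-dimensional case, which is a consequence of Vitali's covering
  theorem (\<open>negligible_nondifferentiable_lipschitz_real\<close>). A Fubini argument along parallel lines
  gives directional derivatives almost everywhere, and an integration over compact sets shows that they
  are additive in the direction (\<open>directional_derivative_additive_AE\<close>). The equations of the flow are solved and
  compared only on short time intervals, where the contraction principle and an absorption argument
  (\<open>short_time_bound\<close>) take the place of a global theory.\<close>

section \<open>Lipschitz functions of one real variable\<close>

lemma emeasure_countable_UN_le:
  assumes "countable J" "\<And>i. i \<in> J \<Longrightarrow> A i \<in> sets M"
  shows "emeasure M (\<Union>i\<in>J. A i) \<le> (\<integral>\<^sup>+i. emeasure M (A i) \<partial>count_space J)"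
proof -
  have "emeasure M (\<Union>i\<in>J. A i) = (\<integral>\<^sup>+x. indicator (\<Union>i\<in>J. A i) x \<partial>M)"
    using assms by (intro nn_integral_indicator[symmetric] sets.countable_UN') auto
  also have "\<dots> \<le> (\<integral>\<^sup>+x. (\<integral>\<^sup>+i. indicator (A i) x \<partial>count_space J) \<partial>M)"
  proof (rule nn_integral_mono)
    fix x
    show "indicator (\<Union>i\<in>J. A i) x \<le> (\<integral>\<^sup>+i. indicator (A i) x \<partial>count_space J)"
    proof (cases "x \<in> (\<Union>i\<in>J. A i)")
      case True
      then obtain i where i: "i \<in> J" "x \<in> A i" by auto
      show ?thesis using nn_integral_ge_point[OF i(1), of "\<lambda>i. indicator (A i) x"] i True by simp
    qed simp
  qed
  also have "\<dots> = (\<integral>\<^sup>+i. (\<integral>\<^sup>+x. indicator (A i) x \<partial>M) \<partial>count_space J)"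
    using assms by (intro nn_integral_count_space_nn_integral) auto
  also have "\<dots> = (\<integral>\<^sup>+i. emeasure M (A i) \<partial>count_space J)"
    using assms by (intro nn_integral_cong) auto
  finally show ?thesis .
qed

text \<open>By Vitali's theorem almost all of \<open>E\<close> is covered by disjoint intervals that lie in an open set
  barely larger than \<open>E\<close> and on which \<open>f\<close> has slope at most \<open>p\<close>. The remaining null set has a null
  image because \<open>f\<close> is Lipschitz.\<close>

lemma mono_image_measure_le_slope:
  fixes f :: "real \<Rightarrow> real"
  assumes lip: "C-lipschitz_on UNIV f" and mono: "mono f" and p: "p > 0"
    and E: "E \<in> sets borel" and fE: "f ` E \<in> sets borel"
    and slope: "\<And>x d. x \<in> E \<Longrightarrow> d > 0 \<Longrightarrow>
      \<exists>c r. 0 < r \<and> r < d \<and> x \<in> ball c r \<and> f (c + r) - f (c - r) \<le> p * (2 * r)"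
  shows "emeasure lborel (f ` E) \<le> ennreal p * emeasure lborel E"
proof -
  have outer: "emeasure lborel (f ` E) \<le> ennreal p * emeasure lborel W" if "open W" "E \<subseteq> W" for W
  proof -
    define K where "K = {(c, r). 0 < r \<and> ball c r \<subseteq> W \<and> f (c + r) - f (c - r) \<le> p * (2 * r)}"
    have "\<exists>i. i \<in> K \<and> x \<in> ball (fst i) (snd i) \<and> snd i < d" if x: "x \<in> E" "0 < d" for x d
    proof -
      obtain e where e: "e > 0" "ball x e \<subseteq> W" using \<open>open W\<close> \<open>E \<subseteq> W\<close> x open_contains_ball by blast
      obtain c r where cr: "0 < r" "r < min d (e/2)" "x \<in> ball c r" "f (c + r) - f (c - r) \<le> p * (2 * r)"
        using slope[OF x(1), of "min d (e/2)"] x e by auto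
      have "ball c r \<subseteq> ball x e"
      proof
        fix y assume "y \<in> ball c r"
        then show "y \<in> ball x e" using cr dist_triangle[of x y c] by (auto simp: dist_commute)
      qed
      then have "(c, r) \<in> K" using cr e unfolding K_def by auto
      then show ?thesis using cr by (intro exI[of _ "(c, r)"]) auto
    qed
    then obtain J where J: "countable J" "J \<subseteq> K"
      "pairwise (\<lambda>i j. disjnt (ball (fst i) (snd i)) (ball (fst j) (snd j))) J"
      "negligible (E - (\<Union>i\<in>J. ball (fst i) (snd i)))"
      using Vitali_covering_theorem_balls[of E K fst snd thesis] by blast
    let ?N = "E - (\<Union>i\<in>J. ball (fst i) (snd i))"
    let ?I = "\<lambda>i. {f (fst i - snd i) .. f (fst i + snd i)}"
    have neg: "negligible (f ` ?N)"
    proof (rule negligible_locally_Lipschitz_image[OF _ J(4)])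
      show "\<exists>T B. open T \<and> x \<in> T \<and> (\<forall>y\<in>?N \<inter> T. norm (f y - f x) \<le> B * norm (y - x))" for x
        using lipschitz_onD[OF lip] by (intro exI[of _ UNIV] exI[of _ C]) (auto simp: dist_norm)
    qed auto
    have disj: "disjoint_family_on (\<lambda>i. ball (fst i) (snd i)) J"
      using J(3) unfolding disjoint_family_on_def pairwise_def disjnt_def by auto
    have sub: "f ` E \<subseteq> f ` ?N \<union> (\<Union>i\<in>J. ?I i)"
    proof
      fix y assume "y \<in> f ` E"
      then obtain x where x: "x \<in> E" "y = f x" by auto
      show "y \<in> f ` ?N \<union> (\<Union>i\<in>J. ?I i)"
      proof (cases "x \<in> ?N")
        case False
        then obtain i where i: "i \<in> J" "x \<in> ball (fst i) (snd i)" using x by auto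
        then have "fst i - snd i \<le> x" "x \<le> fst i + snd i" by (auto simp: dist_real_def)
        then have "y \<in> ?I i" using monoD[OF mono] x by auto
        then show ?thesis using i by blast
      qed (use x in auto)
    qed
    have "emeasure lborel (f ` E) = emeasure lebesgue (f ` E)" using fE by simp
    also have "\<dots> \<le> emeasure lebesgue (f ` ?N \<union> (\<Union>i\<in>J. ?I i))"
      by (intro emeasure_mono sub sets.Un negligible_imp_sets neg sets.countable_UN'[OF J(1)]) auto
    also have "\<dots> \<le> emeasure lebesgue (f ` ?N) + emeasure lebesgue (\<Union>i\<in>J. ?I i)"
      by (intro emeasure_subadditive negligible_imp_sets neg sets.countable_UN'[OF J(1)]) auto
    also have "emeasure lebesgue (f ` ?N) = 0" using neg negligible_iff_emeasure0 negligible_imp_sets by blast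
    also have "0 + emeasure lebesgue (\<Union>i\<in>J. ?I i) \<le> (\<integral>\<^sup>+i. emeasure lebesgue (?I i) \<partial>count_space J)"
      by (subst add_0) (intro emeasure_countable_UN_le J, auto)
    also have "\<dots> \<le> (\<integral>\<^sup>+i. ennreal p * emeasure lborel (ball (fst i) (snd i)) \<partial>count_space J)"
    proof (rule nn_integral_mono)
      fix i assume "i \<in> space (count_space J)"
      then have i: "0 < snd i" "f (fst i + snd i) - f (fst i - snd i) \<le> p * (2 * snd i)"
        using J(2) unfolding K_def by auto
      then have "emeasure lborel (ball (fst i) (snd i)) = ennreal (2 * snd i)"
        by (auto simp: ball_eq_greaterThanLessThan)
      then show "emeasure lebesgue (?I i) \<le> ennreal p * emeasure lborel (ball (fst i) (snd i))"
        using i p monoD[OF mono, of "fst i - snd i" "fst i + snd i"]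
        by (auto simp: ennreal_mult[symmetric] intro!: ennreal_leI)
    qed
    also have "\<dots> = ennreal p * (\<integral>\<^sup>+i. emeasure lborel (ball (fst i) (snd i)) \<partial>count_space J)"
      by (rule nn_integral_cmult) auto
    also have "(\<integral>\<^sup>+i. emeasure lborel (ball (fst i) (snd i)) \<partial>count_space J) = emeasure lborel (\<Union>i\<in>J. ball (fst i) (snd i))"
      by (rule emeasure_UN_countable[symmetric]) (auto simp: J disj)
    also have "ennreal p * \<dots> \<le> ennreal p * emeasure lborel W"
    proof (intro mult_left_mono emeasure_mono UN_least)
      show "ball (fst i) (snd i) \<subseteq> W" if "i \<in> J" for i
        using subsetD[OF J(2) that] by (simp add: K_def case_prod_beta)
    qed (use \<open>open W\<close> in auto)
    finally show ?thesis by simp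
  qed
  show ?thesis
  proof (rule ennreal_le_epsilon)
    fix e :: real assume e: "0 < e"
    obtain W where W: "open W" "E \<subseteq> W" "emeasure lborel (W - E) < ennreal (e / p)"
      using outer_regular_lborel[OF E, of "e/p"] e p by auto
    have "emeasure lborel W = emeasure lborel (E \<union> (W - E))" using W(2) by (simp add: Un_absorb1)
    also have "\<dots> \<le> emeasure lborel E + emeasure lborel (W - E)"
      using E W by (intro emeasure_subadditive) auto
    also have "\<dots> \<le> emeasure lborel E + ennreal (e/p)" using W by (intro add_left_mono) auto
    finally have "ennreal p * emeasure lborel W \<le> ennreal p * (emeasure lborel E + ennreal (e/p))"
      by (rule mult_left_mono) simp
    also have "\<dots> = ennreal p * emeasure lborel E + ennreal e"
      using p e by (simp add: distrib_left ennreal_mult[symmetric])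
    finally show "emeasure lborel (f ` E) \<le> ennreal p * emeasure lborel E + ennreal e"
      using outer[OF W(1,2)] by (rule order_trans[rotated])
  qed
qed

text \<open>The previous lemma applies to \<open>f\<close> with the slope bound \<open>p\<close> and to its inverse \<open>g\<close> with the
  slope bound \<open>1/q\<close>. Together they give \<open>q \<bar>E\<bar> \<le> \<bar>f(E)\<bar> \<le> p \<bar>E\<bar>\<close>, where \<open>p < q\<close>.\<close>

lemma negligible_two_slopes:
  fixes f g :: "real \<Rightarrow> real"
  assumes lf: "C-lipschitz_on UNIV f" and lg: "D-lipschitz_on UNIV g"
    and mf: "strict_mono f" and gf: "\<And>x. g (f x) = x" and fg: "\<And>y. f (g y) = y"
    and pq: "0 < p" "p < q" and E: "E \<in> sets borel"
    and lo: "\<And>x d. x \<in> E \<Longrightarrow> d > 0 \<Longrightarrow>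
      \<exists>c r. 0 < r \<and> r < d \<and> x \<in> ball c r \<and> f (c + r) - f (c - r) < p * (2 * r)"
    and hi: "\<And>x d. x \<in> E \<Longrightarrow> d > 0 \<Longrightarrow>
      \<exists>c r. 0 < r \<and> r < d \<and> x \<in> ball c r \<and> f (c + r) - f (c - r) > q * (2 * r)"
  shows "negligible E"
proof -
  have mg: "mono g"
    by (rule monoI) (use fg strict_mono_less_eq[OF mf] in metis)
  have contf: "continuous_on UNIV f" and contg: "continuous_on UNIV g"
    using lf lg lipschitz_on_continuous_on by blast+
  have im: "f ` A = g -` A" for A
  proof
    show "f ` A \<subseteq> g -` A" using gf by auto
    show "g -` A \<subseteq> f ` A"
    proof
      fix y assume "y \<in> g -` A"
      then show "y \<in> f ` A" using fg[of y, symmetric] by blast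
    qed
  qed
  have bdd: "negligible E'" if E': "E' \<subseteq> E" "E' \<in> sets borel" "emeasure lborel E' < \<infinity>" for E'
  proof -
    have fE': "f ` E' \<in> sets borel" unfolding im using E'(2) contg
      by (metis borel_measurable_continuous_onI measurable_sets_borel)
    have 1: "emeasure lborel (f ` E') \<le> ennreal p * emeasure lborel E'"
      using lo E'(1) by (intro mono_image_measure_le_slope[OF lf strict_mono_mono[OF mf] pq(1) E'(2) fE'])
        (meson less_imp_le subsetD)
    have gfE': "g ` (f ` E') = E'" using gf by (auto simp: image_image)
    have 2: "emeasure lborel (g ` (f ` E')) \<le> ennreal (1/q) * emeasure lborel (f ` E')"
    proof (rule mono_image_measure_le_slope[OF lg mg])
      fix y d :: real assume y: "y \<in> f ` E'" and d: "d > 0"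
      then obtain x where x: "x \<in> E" "y = f x" using E'(1) by auto
      have C: "C \<ge> 0" using lf lipschitz_on_nonneg by blast
      obtain c r where cr: "0 < r" "r < d / (C + 1)" "x \<in> ball c r" "f (c + r) - f (c - r) > q * (2 * r)"
        using hi[OF x(1), of "d / (C+1)"] d C by auto
      let ?c = "(f (c + r) + f (c - r)) / 2" and ?r = "(f (c + r) - f (c - r)) / 2"
      have "?r > q * r" using cr by simp
      moreover have "q * r > 0" using pq cr by simp
      ultimately have r0: "?r > 0" by linarith
      have "\<bar>f (c + r) - f (c - r)\<bar> \<le> C * (2 * r)"
        using lipschitz_onD[OF lf, of "c+r" "c-r"] cr by (simp add: dist_real_def)
      then have "?r \<le> C * r" by simp
      also have "\<dots> \<le> (C + 1) * r" using cr by simp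
      also have "\<dots> < d" using cr C by (simp add: field_simps)
      finally have "?r < d" .
      moreover have "f (c - r) < f x" "f x < f (c + r)"
        using cr mf unfolding strict_mono_def by (auto simp: dist_real_def)
      then have "y \<in> ball ?c ?r" using x by (auto simp: dist_real_def field_simps abs_less_iff)
      moreover have "?c + ?r = f (c + r)" "?c - ?r = f (c - r)" by (simp_all add: field_simps)
      then have "g (?c + ?r) - g (?c - ?r) \<le> 1/q * (2 * ?r)"
        using cr pq gf by (simp add: field_simps)
      ultimately show "\<exists>c r. 0 < r \<and> r < d \<and> y \<in> ball c r \<and> g (c + r) - g (c - r) \<le> 1/q * (2 * r)"
        using r0 by blast
    qed (use pq E' fE' gfE' in auto)
    have "emeasure lborel E' \<le> ennreal (1/q) * (ennreal p * emeasure lborel E')"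
      using 2 mult_left_mono[OF 1, of "ennreal (1/q)"] unfolding gfE' by (auto intro: order_trans)
    then have "emeasure lborel E' \<le> ennreal (p/q) * emeasure lborel E'"
      using pq by (simp add: mult.assoc[symmetric] ennreal_mult[symmetric])
    moreover obtain m where m: "emeasure lborel E' = ennreal m" "m \<ge> 0"
      using E'(3) by (cases "emeasure lborel E'") auto
    ultimately have "m \<le> (p/q) * m" using pq by (simp add: ennreal_mult[symmetric])
    then have "m * (1 - p/q) \<le> 0" by (simp add: algebra_simps)
    moreover have "1 - p/q > 0" using pq by simp
    ultimately have "m = 0" using m(2) by (simp add: mult_le_0_iff)
    then show ?thesis using m E' by (simp add: negligible_iff_emeasure0)
  qed
  have "negligible (\<Union>n::nat. E \<inter> ball 0 (real n))"
  proof (rule negligible_countable_Union)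
    fix T assume "T \<in> range (\<lambda>n::nat. E \<inter> ball 0 (real n))"
    then obtain n where n: "T = E \<inter> ball 0 (real n)" by auto
    have "emeasure lborel T \<le> emeasure lborel (ball 0 (real n) :: real set)"
      unfolding n by (intro emeasure_mono) auto
    then show "negligible T" using emeasure_lborel_ball_finite[of 0 "real n"] E n
      by (intro bdd) (auto intro: order.strict_trans1)
  qed auto
  moreover have "(\<Union>n::nat. E \<inter> ball 0 (real n)) = E"
    using reals_Archimedean2 by fastforce
  ultimately show ?thesis by simp
qed

text \<open>Difference quotients at \<open>x\<close> belong to intervals with \<open>x\<close> as an endpoint, whereas Vitali's theorem
  wants open intervals around \<open>x\<close>. A strict bound on the slope survives a slight enlargement.\<close>

lemma widen_interval_slope:
  fixes f :: "real \<Rightarrow> real"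
  assumes cont: "continuous_on UNIV f" and ab: "a \<le> x" "x \<le> b" "a < b" "b - a < d"
    and slope: "f b - f a < p * (b - a)"
  shows "\<exists>c r. 0 < r \<and> r < d \<and> x \<in> ball c r \<and> f (c + r) - f (c - r) < p * (2 * r)"
proof -
  let ?g = "\<lambda>\<eta>. f (b + \<eta>) - f (a - \<eta>) - p * (b - a + 2 * \<eta>)"
  have "continuous_on UNIV ?g"
    by (intro continuous_intros continuous_on_compose2[OF cont]) auto
  then have "(?g \<longlongrightarrow> ?g 0) (at 0)" unfolding continuous_on_def by blast
  then have "eventually (\<lambda>\<eta>. ?g \<eta> < 0) (at 0)" using slope by (intro order_tendstoD) auto
  then obtain \<delta> where \<delta>: "\<delta> > 0" "\<And>\<eta>. \<eta> \<noteq> 0 \<Longrightarrow> \<bar>\<eta>\<bar> < \<delta> \<Longrightarrow> ?g \<eta> < 0"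
    unfolding eventually_at by (auto simp: dist_real_def)
  define \<eta> where "\<eta> = min (\<delta>/2) ((d - (b - a)) / 2)"
  have \<eta>: "\<eta> > 0" "?g \<eta> < 0" "\<eta> < d - (b - a)" using \<delta> ab unfolding \<eta>_def by (auto simp: min_def)
  let ?c = "(a + b)/2" and ?r = "(b - a)/2 + \<eta>"
  have e: "?c + ?r = b + \<eta>" "?c - ?r = a - \<eta>" "2 * ?r = b - a + 2 * \<eta>" by (auto simp: field_simps)
  have "f (?c + ?r) - f (?c - ?r) < p * (2 * ?r)" unfolding e using \<eta>(2) by linarith
  moreover have "x \<in> ball ?c ?r" using ab \<eta> by (auto simp: dist_real_def abs_less_iff field_simps)
  moreover have "0 < ?r" "?r < d"
  proof -
    have "0 < (b - a) / 2" "(b - a) / 2 < b - a" using ab by auto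
    then show "0 < ?r" "?r < d" using \<eta>(1,3) by linarith+
  qed
  ultimately show ?thesis by blast
qed

text \<open>Adding a steep linear function turns \<open>F\<close> into an increasing bi-Lipschitz function. At a point
  where the difference quotients do not converge, two rational numbers separate their lower and upper
  limits. For each of the countably many pairs of rationals \<open>negligible_two_slopes\<close> applies.\<close>

lemma negligible_nondifferentiable_lipschitz_real:
  fixes F :: "real \<Rightarrow> real"
  assumes lip: "L-lipschitz_on UNIV F"
  shows "negligible {x. \<not> F differentiable (at x)}"
proof -
  define f where "f x = F x + (L + 1) * x" for x
  have L: "L \<ge> 0" using lip lipschitz_on_nonneg by blast
  have Fd: "\<bar>F y - F x\<bar> \<le> L * \<bar>y - x\<bar>" for x y using lipschitz_onD[OF lip, of y x] by (simp add: dist_real_def)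
  have up: "f y - f x \<ge> y - x" "f y - f x \<le> (2 * L + 1) * (y - x)" if "x \<le> y" for x y
    using Fd[of y x] that by (auto simp: f_def algebra_simps)
  have mf: "strict_mono f" using up(1) unfolding strict_mono_def by (smt (verit))
  have lf: "(2*L+1)-lipschitz_on UNIV f"
  proof (rule lipschitz_onI)
    show "dist (f x) (f y) \<le> (2 * L + 1) * dist x y" for x y
      using up[of x y] up[of y x] by (cases "x \<le> y") (auto simp: dist_real_def)
  qed (use L in auto)
  then have contf: "continuous_on UNIV f" using lipschitz_on_continuous_on by blast
  have surj: "\<exists>x. f x = y" for y
  proof -
    define b where "b = \<bar>y - f 0\<bar>"
    have "f (-b) \<le> y" "y \<le> f b" using up(1)[of "-b" 0] up(1)[of 0 b] unfolding b_def by auto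
    then have "\<exists>x\<ge>-b. x \<le> b \<and> f x = y"
      using contf by (intro IVT') (auto simp: b_def intro: continuous_on_subset)
    then show ?thesis by blast
  qed
  define g where "g = inv f"
  have gf: "g (f x) = x" for x unfolding g_def by (rule inv_f_f[OF strict_mono_imp_inj_on[OF mf]])
  have fg: "f (g y) = y" for y unfolding g_def using surj by (metis f_inv_into_f rangeI)
  have lg: "1-lipschitz_on UNIV g"
  proof (rule lipschitz_onI)
    show "dist (g x) (g y) \<le> 1 * dist x y" for x y
      using up(1)[of "g x" "g y"] up(1)[of "g y" "g x"] fg by (cases "g x \<le> g y") (auto simp: dist_real_def)
  qed auto
  define Lo where "Lo p = {x. \<forall>d>0. \<exists>c r. 0 < r \<and> r < d \<and> x \<in> ball c r \<and> f (c + r) - f (c - r) < p * (2 * r)}" for p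
  define Hi where "Hi q = {x. \<forall>d>0. \<exists>c r. 0 < r \<and> r < d \<and> x \<in> ball c r \<and> f (c + r) - f (c - r) > q * (2 * r)}" for q
  \<comment> \<open>The condition defines a \<open>G\<^sub>\<delta>\<close> set: the bounds \<open>1/n\<close> on the radius suffice, and for each of them the
    admissible \<open>x\<close> form a union of open balls.\<close>
  have gdel: "{x::real. \<forall>d>0. \<exists>c r. 0 < r \<and> r < d \<and> x \<in> ball c r \<and> P c r} \<in> sets borel" for P
  proof -
    define G where "G d = \<Union> {B. \<exists>c r. B = ball c r \<and> 0 < r \<and> r < d \<and> P c r}" for d :: real
    have G: "x \<in> G d \<longleftrightarrow> (\<exists>c r. 0 < r \<and> r < d \<and> x \<in> ball c r \<and> P c r)" for x d
      unfolding G_def by blast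
    have "open (G d)" for d unfolding G_def by (rule open_Union) auto
    then have "(\<Inter>n::nat. G (1 / real (Suc n))) \<in> sets borel" by auto
    moreover have "{x. \<forall>d>0. x \<in> G d} = (\<Inter>n::nat. G (1 / real (Suc n)))"
    proof -
      have "x \<in> G d" if x: "x \<in> (\<Inter>n::nat. G (1 / real (Suc n)))" and "0 < d" for x d
      proof -
        obtain n where n: "1 / real (Suc n) < d" using nat_approx_posE[OF \<open>0 < d\<close>] by blast
        then show ?thesis using x unfolding INT_iff G by (meson UNIV_I less_trans)
      qed
      then show ?thesis by auto
    qed
    ultimately show ?thesis unfolding G by simp
  qed
  have neg: "negligible (Lo p \<inter> Hi q)" if "0 < p" "p < q" for p q
  proof (rule negligible_two_slopes[OF lf lg mf gf fg that])
    show "Lo p \<inter> Hi q \<in> sets borel" unfolding Lo_def Hi_def using gdel by auto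
  qed (auto simp: Lo_def Hi_def)
  have sub: "{x. \<not> F differentiable (at x)} \<subseteq> (\<Union>(p,q)\<in>{(p,q). p \<in> \<rat> \<and> q \<in> \<rat> \<and> 0 < p \<and> p < q}. Lo p \<inter> Hi q)"
  proof (rule subsetI, rule ccontr)
    fix x assume x: "x \<in> {x. \<not> F differentiable (at x)}"
      and nx: "x \<notin> (\<Union>(p,q)\<in>{(p,q). p \<in> \<rat> \<and> q \<in> \<rat> \<and> 0 < p \<and> p < q}. Lo p \<inter> Hi q)"
    define \<phi> where "\<phi> h = (f (x + h) - f x) / h" for h
    have \<phi>: "1 \<le> \<phi> h" "\<phi> h \<le> 2 * L + 1" if "h \<noteq> 0" for h
      using that up[of x "x+h"] up[of "x+h" x] unfolding \<phi>_def
      by (cases "h > 0"; auto simp: field_simps divide_simps)+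
    have ev1: "eventually (\<lambda>h. 1 \<le> ereal (\<phi> h)) (at 0)" and ev2: "eventually (\<lambda>h. ereal (\<phi> h) \<le> ereal (2*L+1)) (at 0)"
      using \<phi> by (auto simp: eventually_at intro!: exI[of _ 1])
    let ?l = "Liminf (at 0) (\<lambda>h. ereal (\<phi> h))" and ?u = "Limsup (at 0) (\<lambda>h. ereal (\<phi> h))"
    have l1: "1 \<le> ?l" using ev1 by (rule Liminf_bounded)
    have u1: "?u \<le> ereal (2*L+1)" using ev2 by (rule Limsup_bounded)
    have lu: "?l \<le> ?u" by (rule Liminf_le_Limsup) simp
    show False
    proof (cases "?l = ?u")
      case True
      then obtain r where r: "?l = ereal r" using l1 u1 lu True by (metis MInfty_neq_ereal(1) PInfty_neq_ereal(1) ereal_infty_less_eq(1,2) one_ereal_def real_of_ereal.elims)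
      have "((\<lambda>h. ereal (\<phi> h)) \<longlongrightarrow> ereal r) (at 0)"
        using r True by (intro Liminf_eq_Limsup) auto
      then have "(\<phi> \<longlongrightarrow> r) (at 0)" by simp
      then have "(f has_field_derivative r) (at x)" unfolding DERIV_def \<phi>_def .
      then have "((\<lambda>x. f x - (L + 1) * x) has_field_derivative (r - (L+1) * 1)) (at x)"
        by (intro DERIV_diff) (auto intro!: derivative_eq_intros)
      then have "(F has_field_derivative (r - (L+1) * 1)) (at x)" unfolding f_def by simp
      then show False using x real_differentiable_def by blast
    next
      case False
      then have "?l < ?u" using lu by simp
      then obtain m where m: "?l < ereal m" "ereal m < ?u" using ereal_dense2 by blast
      obtain m2 where m2: "ereal m < ereal m2" "ereal m2 < ?u" using m ereal_dense2 by blast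
      obtain m1 where m1: "?l < ereal m1" "ereal m1 < ereal m" using m ereal_dense2 by blast
      obtain p where p: "p \<in> \<rat>" "m1 < p" "p < m" using Rats_dense_in_real m1 by auto
      obtain q where q: "q \<in> \<rat>" "m < q" "q < m2" using Rats_dense_in_real m2 by auto
      have "ereal 1 < ereal m1" using order.strict_trans1[OF l1 m1(1)] by simp
      then have p0: "0 < p" using p by simp
      have F1: "frequently (\<lambda>h. \<phi> h < p) (at 0)"
      proof (rule ccontr)
        assume "\<not> ?thesis"
        then have "eventually (\<lambda>h. ereal p \<le> ereal (\<phi> h)) (at 0)" by (simp add: not_frequently not_less)
        then have "ereal p \<le> ?l" by (rule Liminf_bounded)
        then show False using m1 p by (meson ereal_less_le less_ereal.simps(1) less_imp_le not_less order.trans)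
      qed
      have F2: "frequently (\<lambda>h. \<phi> h > q) (at 0)"
      proof (rule ccontr)
        assume "\<not> ?thesis"
        then have "eventually (\<lambda>h. ereal (\<phi> h) \<le> ereal q) (at 0)" by (simp add: not_frequently not_less)
        then have "?u \<le> ereal q" by (rule Limsup_bounded)
        then show False using m2 q by (meson ereal_less_le less_ereal.simps(1) less_imp_le not_less order.trans)
      qed
      have "x \<in> Lo p" unfolding Lo_def
      proof (intro CollectI allI impI)
        fix d :: real assume "0 < d"
        then obtain h where h: "h \<noteq> 0" "\<bar>h\<bar> < d" "\<phi> h < p"
          using F1 unfolding frequently_at by (force simp: dist_real_def)
        show "\<exists>c r. 0 < r \<and> r < d \<and> x \<in> ball c r \<and> f (c + r) - f (c - r) < p * (2 * r)"
          using widen_interval_slope[OF contf, of x x "x+h" d p] widen_interval_slope[OF contf, of "x+h" x x d p] h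
          unfolding \<phi>_def by (cases "h > 0") (auto simp: field_simps divide_simps)
      qed
      moreover have "x \<in> Hi q" unfolding Hi_def
      proof (intro CollectI allI impI)
        fix d :: real assume "0 < d"
        then obtain h where h: "h \<noteq> 0" "\<bar>h\<bar> < d" "\<phi> h > q"
          using F2 unfolding frequently_at by (force simp: dist_real_def)
        have "continuous_on UNIV (\<lambda>x. - f x)" by (intro continuous_intros contf)
        note w = widen_interval_slope[OF this]
        have "\<exists>c r. 0 < r \<and> r < d \<and> x \<in> ball c r \<and> - f (c + r) - - f (c - r) < (-q) * (2 * r)"
          using w[of x x "x+h" d "-q"] w[of "x+h" x x d "-q"] h
          unfolding \<phi>_def by (cases "h > 0") (auto simp: field_simps divide_simps)
        then show "\<exists>c r. 0 < r \<and> r < d \<and> x \<in> ball c r \<and> f (c + r) - f (c - r) > q * (2 * r)"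
          by (smt (verit) mult_minus_left)
      qed
      ultimately show False using nx p q p0 by auto
    qed
  qed
  have "negligible (\<Union>(p,q)\<in>{(p,q). p \<in> \<rat> \<and> q \<in> \<rat> \<and> 0 < p \<and> p < q}. Lo p \<inter> Hi q)"
  proof (rule negligible_countable_Union)
    have "countable (\<rat> \<times> \<rat> :: (real \<times> real) set)" by (intro countable_SIGMA countable_rat)
    then have "countable {(p::real,q::real). p \<in> \<rat> \<and> q \<in> \<rat> \<and> 0 < p \<and> p < q}"
      by (rule countable_subset[rotated]) auto
    then show "countable ((\<lambda>(p,q). Lo p \<inter> Hi q) ` {(p,q). p \<in> \<rat> \<and> q \<in> \<rat> \<and> 0 < p \<and> p < q})" by auto
  qed (use neg in auto)
  then show ?thesis using sub negligible_subset by blast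
qed

section \<open>Directional derivatives of Lipschitz functions\<close>

lemma lborel_integral_shift:
  fixes g :: "'a::euclidean_space \<Rightarrow> real"
  assumes g: "g \<in> borel_measurable borel"
  shows "(\<integral>x. g (x + c) \<partial>lborel) = integral\<^sup>L lborel g"
proof -
  have "integral\<^sup>L lborel g = integral\<^sup>L (distr lborel borel ((+) c)) g"
    by (simp add: lborel_distr_plus)
  also have "\<dots> = (\<integral>x. g (c + x) \<partial>lborel)"
    using g by (intro integral_distr) auto
  finally show ?thesis by (simp add: add.commute)
qed

lemma lborel_integrable_shift:
  fixes g :: "'a::euclidean_space \<Rightarrow> real"
  assumes g: "integrable lborel g"
  shows "integrable lborel (\<lambda>x. g (x + c))"
proof -
  have "integrable (distr lborel borel ((+) c)) g" using g by (simp add: lborel_distr_plus)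
  then have "integrable lborel (\<lambda>x. g (c + x))"
    using g by (subst (asm) integrable_distr_eq) auto
  then show ?thesis by (simp add: add.commute)
qed

text \<open>Integrate the indicator function of \<open>{(x, t). x + t e \<in> N}\<close>. The integral over \<open>t\<close> vanishes for every
  \<open>x\<close>, while by translation invariance the integral over \<open>x\<close> is \<open>\<bar>N\<bar>\<close> for every \<open>t\<close>. In this form
  Fubini's theorem works for every direction without a change of coordinates.\<close>

lemma negligible_if_null_on_parallel_lines:
  fixes N :: "'a::euclidean_space set"
  assumes N: "N \<in> sets borel" and null: "\<And>x. negligible {t::real. x + t *\<^sub>R e \<in> N}"
  shows "negligible N"
proof -
  have [measurable]: "N \<in> sets borel" by (rule N)
  have *: "(\<integral>\<^sup>+t. indicator N (x + t *\<^sub>R e) \<partial>lborel) = 0" for x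
  proof -
    have "{t::real. x + t *\<^sub>R e \<in> N} \<in> sets borel" by measurable
    then have "emeasure lborel {t::real. x + t *\<^sub>R e \<in> N} = 0"
      using null[of x] by (simp add: negligible_iff_emeasure0)
    moreover have "(\<lambda>t. indicator N (x + t *\<^sub>R e) :: ennreal) = indicator {t. x + t *\<^sub>R e \<in> N}"
      by (auto simp: indicator_def)
    ultimately show ?thesis by simp
  qed
  have shift: "(\<integral>\<^sup>+x. indicator N (x + t *\<^sub>R e) \<partial>lborel) = emeasure lborel N" for t :: real
  proof -
    have "emeasure lborel N = integral\<^sup>N (distr lborel borel ((+) (t *\<^sub>R e))) (indicator N)"
      by (simp add: lborel_distr_plus)
    also have "\<dots> = (\<integral>\<^sup>+x. indicator N (t *\<^sub>R e + x) \<partial>lborel)"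
      by (intro nn_integral_distr) auto
    finally show ?thesis by (simp add: add.commute)
  qed
  have "(\<integral>\<^sup>+x. (\<integral>\<^sup>+t. indicator N (x + t *\<^sub>R e) \<partial>lborel) \<partial>lborel)
      = (\<integral>\<^sup>+t. (\<integral>\<^sup>+x. indicator N (x + t *\<^sub>R e) \<partial>lborel) \<partial>(lborel :: real measure))"
    by (rule lborel_pair.Fubini'[symmetric]) measurable
  then have "emeasure lborel N * \<infinity> = 0"
    unfolding * shift by simp
  then have "emeasure lborel N = 0" by (simp add: ennreal_mult_eq_top_iff)
  then show ?thesis using N by (simp add: negligible_iff_emeasure0)
qed

abbreviation has_directional_derivative ::
    "('a::real_vector \<Rightarrow> real) \<Rightarrow> 'a \<Rightarrow> 'a \<Rightarrow> real \<Rightarrow> bool" where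
  "has_directional_derivative f u x l \<equiv> ((\<lambda>t. f (x + t *\<^sub>R u)) has_field_derivative l) (at 0)"

text \<open>In the Cauchy form every inequality describes a closed set of points \<open>x\<close> if \<open>f\<close> is continuous. This
  makes the set where the directional derivative exists a Borel set.\<close>

lemma has_directional_derivative_iff_Cauchy:
  "(\<exists>l. has_directional_derivative f u x l) \<longleftrightarrow>
    (\<forall>n::nat. \<exists>m::nat. \<forall>h k. h \<noteq> 0 \<and> k \<noteq> 0 \<and> \<bar>h\<bar> < 1 / real (Suc m) \<and> \<bar>k\<bar> < 1 / real (Suc m) \<longrightarrow>
       \<bar>(f (x + h *\<^sub>R u) - f x) / h - (f (x + k *\<^sub>R u) - f x) / k\<bar> \<le> 1 / real (Suc n))"
  (is "?L \<longleftrightarrow> ?R")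
proof -
  define q where "q h = (f (x + h *\<^sub>R u) - f x) / h" for h
  have L: "?L \<longleftrightarrow> (\<exists>l. (q \<longlongrightarrow> l) (at 0))" unfolding DERIV_def q_def by simp
  have "(\<exists>l. (q \<longlongrightarrow> l) (at 0)) \<longleftrightarrow> (\<forall>n::nat. \<exists>m::nat. \<forall>h k. h \<noteq> 0 \<and> k \<noteq> 0 \<and> \<bar>h\<bar> < 1 / real (Suc m) \<and> \<bar>k\<bar> < 1 / real (Suc m) \<longrightarrow>
       \<bar>q h - q k\<bar> \<le> 1 / real (Suc n))" (is "?A \<longleftrightarrow> ?B")
  proof
    assume ?A
    then obtain l where l: "(q \<longlongrightarrow> l) (at 0)" by blast
    show ?B
    proof
      fix n
      define c where "c = 1 / real (Suc n)"
      have "eventually (\<lambda>h. dist (q h) l < 1 / real (Suc n) / 2) (at 0)"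
        using l by (rule tendstoD) simp
      then obtain d where d: "d > 0" "\<And>h. h \<noteq> 0 \<Longrightarrow> \<bar>h\<bar> < d \<Longrightarrow> dist (q h) l < 1 / real (Suc n) / 2"
        unfolding eventually_at by (auto simp: dist_real_def)
      obtain m where m: "1 / real (Suc m) < d" using nat_approx_posE[OF d(1)] by blast
      have "\<bar>q h - q k\<bar> \<le> 1 / real (Suc n)" if "h \<noteq> 0" "k \<noteq> 0" "\<bar>h\<bar> < 1 / real (Suc m)" "\<bar>k\<bar> < 1 / real (Suc m)" for h k
      proof -
        have "dist (q h) l < 1 / real (Suc n) / 2" "dist (q k) l < 1 / real (Suc n) / 2"
          using d(2)[OF that(1) less_trans[OF that(3) m]] d(2)[OF that(2) less_trans[OF that(4) m]] .
        then have "\<bar>q h - l\<bar> < c / 2" "\<bar>q k - l\<bar> < c / 2" unfolding dist_real_def c_def .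
        then have "\<bar>q h - q k\<bar> \<le> c" by linarith
        then show ?thesis unfolding c_def .
      qed
      then show "\<exists>m::nat. \<forall>h k. h \<noteq> 0 \<and> k \<noteq> 0 \<and> \<bar>h\<bar> < 1 / real (Suc m) \<and> \<bar>k\<bar> < 1 / real (Suc m) \<longrightarrow>
       \<bar>q h - q k\<bar> \<le> 1 / real (Suc n)" by blast
    qed
  next
    assume B: ?B
    define s where "s i = 1 / (real (Suc (Suc i)))" for i
    have s: "s i \<noteq> 0" "\<bar>s i\<bar> < 1 / real (Suc m)" if "i \<ge> m" for i m
      using that unfolding s_def by (auto intro!: divide_strict_left_mono)
    have "Cauchy (\<lambda>i. q (s i))"
    proof (rule metric_CauchyI)
      fix e :: real assume "0 < e"
      then obtain n where n: "1 / real (Suc n) < e" using nat_approx_posE by blast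
      obtain m where m: "\<And>h k. h \<noteq> 0 \<Longrightarrow> k \<noteq> 0 \<Longrightarrow> \<bar>h\<bar> < 1 / real (Suc m) \<Longrightarrow> \<bar>k\<bar> < 1 / real (Suc m) \<Longrightarrow>
       \<bar>q h - q k\<bar> \<le> 1 / real (Suc n)" using B by blast
      have "dist (q (s i)) (q (s j)) < e" if "i \<ge> m" "j \<ge> m" for i j
        using m[OF s(1)[OF that(1)] s(1)[OF that(2)] s(2)[OF that(1)] s(2)[OF that(2)]] n
        unfolding dist_real_def by linarith
      then show "\<exists>M. \<forall>i\<ge>M. \<forall>j\<ge>M. dist (q (s i)) (q (s j)) < e" by blast
    qed
    then obtain l where l: "(\<lambda>i. q (s i)) \<longlonglongrightarrow> l" using Cauchy_convergent convergent_def by blast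
    have "(q \<longlongrightarrow> l) (at 0)"
    proof (rule tendstoI)
      fix e :: real assume "0 < e"
      then obtain n where n: "1 / real (Suc n) < e" using nat_approx_posE by blast
      obtain m where m: "\<And>h k. h \<noteq> 0 \<Longrightarrow> k \<noteq> 0 \<Longrightarrow> \<bar>h\<bar> < 1 / real (Suc m) \<Longrightarrow> \<bar>k\<bar> < 1 / real (Suc m) \<Longrightarrow>
       \<bar>q h - q k\<bar> \<le> 1 / real (Suc n)" using B by blast
      have "dist (q h) l < e" if h: "h \<noteq> 0" "\<bar>h\<bar> < 1 / real (Suc m)" for h
      proof -
        have "(\<lambda>i. \<bar>q h - q (s i)\<bar>) \<longlonglongrightarrow> \<bar>q h - l\<bar>" by (intro tendsto_intros l)
        moreover have "\<forall>i\<ge>m. \<bar>q h - q (s i)\<bar> \<le> 1 / real (Suc n)" using m h s by simp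
        ultimately have "\<bar>q h - l\<bar> \<le> 1 / real (Suc n)" by (intro LIMSEQ_le_const2) auto
        then show ?thesis using n unfolding dist_real_def by linarith
      qed
      then show "\<forall>\<^sub>F h in at 0. dist (q h) l < e"
        unfolding eventually_at by (intro exI[of _ "1 / real (Suc m)"]) (auto simp: dist_real_def)
    qed
    then show ?A by blast
  qed
  then show ?thesis unfolding L unfolding q_def .
qed

lemma directional_derivative_exists_AE:
  fixes f :: "'a::euclidean_space \<Rightarrow> real"
  assumes lip: "L-lipschitz_on UNIV f"
  shows "AE x in lborel. \<exists>l. has_directional_derivative f u x l"
proof -
  have cont: "continuous_on A f" for A
    using lip lipschitz_on_continuous_on continuous_on_subset by blast
  let ?P = "\<lambda>n m h k x. h \<noteq> 0 \<and> k \<noteq> 0 \<and> \<bar>h\<bar> < 1 / real (Suc m) \<and> \<bar>k\<bar> < 1 / real (Suc m) \<longrightarrow>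
       \<bar>(f (x + h *\<^sub>R u) - f x) / h - (f (x + k *\<^sub>R u) - f x) / k\<bar> \<le> 1 / real (Suc n)"
  let ?G = "{x. \<exists>l. has_directional_derivative f u x l}"
  have "closed {x. ?P n m h k x}" for n m :: nat and h k
  proof (cases "h \<noteq> 0 \<and> k \<noteq> 0 \<and> \<bar>h\<bar> < 1 / real (Suc m) \<and> \<bar>k\<bar> < 1 / real (Suc m)")
    case True
    have "closed {x. \<bar>(f (x + h *\<^sub>R u) - f x) / h - (f (x + k *\<^sub>R u) - f x) / k\<bar> \<le> 1 / real (Suc n)}"
      using True by (intro closed_Collect_le continuous_intros continuous_on_compose2[OF cont]) auto
    then show ?thesis using True by simp
  next
    case False
    then have "{x. ?P n m h k x} = UNIV" by blast
    then show ?thesis by simp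
  qed
  then have "closed (\<Inter>h. \<Inter>k. {x. ?P n m h k x})" for n m :: nat by (intro closed_INT ballI)
  moreover define Z where "Z n m = (\<Inter>h. \<Inter>k. {x. ?P n m h k x})" for n m :: nat
  ultimately have "Z n m \<in> sets borel" for n m by (simp add: borel_closed)
  then have "(\<Inter>n. \<Union>m. Z n m) \<in> sets borel" by auto
  moreover have "?G = (\<Inter>n. \<Union>m. Z n m)"
    unfolding has_directional_derivative_iff_Cauchy Z_def by (simp only: set_eq_iff mem_Collect_eq INT_iff UN_iff UNIV_I ball_UNIV bex_UNIV) simp
  ultimately have G: "?G \<in> sets borel" by simp
  have "negligible (- ?G)"
  proof (rule negligible_if_null_on_parallel_lines[where e = u])
    show "- ?G \<in> sets borel" using G by (rule borel_comp)
    fix x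
    let ?F = "\<lambda>t. f (x + t *\<^sub>R u)"
    have "(L * norm u)-lipschitz_on UNIV ?F"
    proof (rule lipschitz_onI)
      fix s t :: real
      have "dist (?F s) (?F t) \<le> L * dist (x + s *\<^sub>R u) (x + t *\<^sub>R u)"
        by (rule lipschitz_onD[OF lip]) auto
      also have "dist (x + s *\<^sub>R u) (x + t *\<^sub>R u) = norm u * dist s t"
      proof -
        have "x + s *\<^sub>R u - (x + t *\<^sub>R u) = (s - t) *\<^sub>R u" by (simp add: algebra_simps)
        then show ?thesis by (simp add: dist_norm)
      qed
      finally show "dist (?F s) (?F t) \<le> L * norm u * dist s t" by simp
    qed (use lipschitz_on_nonneg[OF lip] in simp)
    then have "negligible {t. \<not> ?F differentiable (at t)}"
      by (rule negligible_nondifferentiable_lipschitz_real)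
    moreover have "{t. x + t *\<^sub>R u \<in> - ?G} \<subseteq> {t. \<not> ?F differentiable (at t)}"
    proof (clarsimp)
      fix t assume n: "\<forall>l. \<not> has_directional_derivative f u (x + t *\<^sub>R u) l" and "?F differentiable (at t)"
      then obtain l where "(?F has_field_derivative l) (at t)" using real_differentiable_def by blast
      then have "((\<lambda>s. ?F (s + t)) has_field_derivative l) (at 0)"
        using DERIV_shift[of ?F l 0 t] by simp
      then have "has_directional_derivative f u (x + t *\<^sub>R u) l"
        by (simp add: algebra_simps)
      then show False using n by blast
    qed
    ultimately show "negligible {t. x + t *\<^sub>R u \<in> - ?G}" using negligible_subset by blast
  qed
  moreover have "{x \<in> space lborel. \<not> (\<exists>l. has_directional_derivative f u x l)} = - ?G" by auto
  ultimately show ?thesis using G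
    by (intro AE_I[where N = "- ?G"]) (auto simp: negligible_iff_emeasure0)
qed

text \<open>If \<open>g\<close> were positive on a set of positive measure, inner regularity would yield a compact subset
  of positive measure on which \<open>g\<close> is positive.\<close>

lemma AE_zero_if_integral_compact_zero:
  fixes g :: "'a::euclidean_space \<Rightarrow> real"
  assumes g[measurable]: "g \<in> borel_measurable borel" and B: "\<And>x. \<bar>g x\<bar> \<le> B"
    and z: "\<And>C. compact C \<Longrightarrow> (\<integral>x. indicator C x * g x \<partial>lborel) = 0"
  shows "AE x in lborel. g x = 0"
proof -
  have pos: "AE x in lborel. \<not> g x > 0"
    if g[measurable]: "g \<in> borel_measurable borel" and B: "\<And>x. \<bar>g x\<bar> \<le> B"
      and z: "\<And>C. compact C \<Longrightarrow> (\<integral>x. indicator C x * g x \<partial>lborel) = 0" for g :: "'a \<Rightarrow> real"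
  proof -
    have "negligible {x \<in> ball 0 (real n). g x > 0}" for n
    proof (rule ccontr)
      let ?P = "{x \<in> ball 0 (real n). g x > 0}"
      assume "\<not> negligible ?P"
      have P: "?P \<in> sets borel" by measurable
      then have e: "emeasure lborel ?P \<noteq> 0" using \<open>\<not> negligible ?P\<close> by (simp add: negligible_iff_emeasure0)
      have "emeasure lborel ?P \<le> emeasure lborel (ball (0::'a) (real n))" by (intro emeasure_mono) auto
      then have "emeasure lborel ?P < \<infinity>" using emeasure_lborel_ball_finite by (rule order.strict_trans1)
      then obtain m where m: "emeasure lborel ?P = ennreal m" "m > 0"
      proof -
        obtain m where m: "emeasure lborel ?P = ennreal m" "m \<ge> 0"
          using \<open>emeasure lborel ?P < \<infinity>\<close> by (cases "emeasure lborel ?P") auto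
        moreover have "m \<noteq> 0" using e m by auto
        ultimately show thesis using that[of m] by simp
      qed
      obtain T where T: "closed T" "T \<subseteq> ?P" "emeasure lebesgue (?P - T) < ennreal m"
      proof -
        have "?P \<in> sets lebesgue" using P by simp
        then show thesis using m(2) that by (rule sets_lebesgue_inner_closed)
      qed
      have "T \<subseteq> ball 0 (real n)" using T(2) by auto
      then have "bounded T" by (rule bounded_subset[OF bounded_ball])
      then have cT: "compact T" using T(1) by (simp add: compact_eq_bounded_closed)
      have [measurable]: "T \<in> sets borel" using T(1) by simp
      have fin: "emeasure lborel T < \<infinity>" by (rule emeasure_bounded_finite[OF \<open>bounded T\<close>])
      have int: "integrable lborel (\<lambda>x. indicator T x * g x)"
      proof (rule Bochner_Integration.integrable_bound[where f = "\<lambda>x. B * indicator T x"])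
        show "AE x in lborel. norm (indicator T x * g x) \<le> norm (B * indicator T x :: real)"
          using B by (auto simp: indicator_def intro!: order_trans[OF B])
      qed (use fin in auto)
      have nn: "AE x in lborel. 0 \<le> indicator T x * g x" using T(2) by (intro AE_I2) (auto simp: indicator_def)
      have "AE x in lborel. indicator T x * g x = 0"
        using integral_nonneg_eq_0_iff_AE[OF int nn] z[OF cT] by simp
      then have "AE x in lborel. x \<notin> T"
        by eventually_elim (use T(2) in \<open>auto simp: indicator_def split: if_splits\<close>)
      then have T0: "emeasure lborel T = 0" by (subst (asm) AE_iff_measurable[of T]) auto
      have "emeasure lborel ?P \<le> emeasure lborel (T \<union> (?P - T))" using P T by (intro emeasure_mono) auto
      also have "\<dots> \<le> emeasure lborel T + emeasure lborel (?P - T)" using P by (intro emeasure_subadditive) auto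
      also have "\<dots> < ennreal m" using T0 T(3) P by simp
      finally show False using m by simp
    qed
    then have "negligible (\<Union>n. {x \<in> ball 0 (real n). g x > 0})" by (intro negligible_countable_Union) auto
    moreover have "(\<Union>n. {x \<in> ball 0 (real n). g x > 0}) = {x. g x > 0}"
      using reals_Archimedean2 by fastforce
    moreover have "{x. g x > 0} \<in> sets borel" by measurable
    ultimately have "emeasure lborel {x. g x > 0} = 0" by (simp add: negligible_iff_emeasure0)
    then show ?thesis using \<open>{x. g x > 0} \<in> sets borel\<close> by (subst AE_iff_measurable[of "{x. g x > 0}"]) auto
  qed
  have "AE x in lborel. \<not> - g x > 0"
    using B z by (intro pos) auto
  moreover have "AE x in lborel. \<not> g x > 0" using g B z by (rule pos)
  ultimately show ?thesis by eventually_elim auto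
qed

text \<open>Since \<open>C\<close> is closed, the positive part of the difference of the two indicator functions tends to \<open>0\<close>
  pointwise. The negative part has the same integral, because a translate of \<open>C\<close> has the measure of \<open>C\<close>.\<close>

lemma indicator_compact_translate_L1:
  fixes C :: "'a::euclidean_space set"
  assumes C: "compact C" and s: "s \<longlonglongrightarrow> 0" "\<And>n. \<bar>s n\<bar> \<le> 1"
  shows "(\<lambda>n. \<integral>y. \<bar>indicator C (y - s n *\<^sub>R w) - indicator C y\<bar> \<partial>lborel) \<longlonglongrightarrow> (0::real)"
proof -
  have [measurable]: "C \<in> sets borel" using C compact_imp_closed borel_closed by blast
  let ?a = "\<lambda>n y. indicator C (y - s n *\<^sub>R w) :: real"
  let ?p = "\<lambda>n y. max (?a n y - indicator C y) 0"
  have intC: "integrable lborel (indicator C :: 'a \<Rightarrow> real)"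
    using emeasure_bounded_finite[OF compact_imp_bounded[OF C]] by simp
  have inta: "integrable lborel (?a n)" for n
    using lborel_integrable_shift[OF intC, of "- s n *\<^sub>R w"] by simp
  obtain r where "\<forall>x\<in>C. norm x \<le> r"
    using compact_imp_bounded[OF C] unfolding bounded_pos by blast
  then have r: "C \<subseteq> cball 0 r" by auto
  let ?D = "cball (0::'a) (r + norm w)"
  have intD: "integrable lborel (indicator ?D :: 'a \<Rightarrow> real)"
    using emeasure_bounded_finite[of ?D] by simp
  have "(\<lambda>n. integral\<^sup>L lborel (?p n)) \<longlonglongrightarrow> (\<integral>y. (0::real) \<partial>(lborel::'a measure))"
  proof (rule integral_dominated_convergence[where w = "indicator ?D"])
    show "AE y in lborel. (\<lambda>n. ?p n y) \<longlonglongrightarrow> 0"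
    proof (rule AE_I2)
      fix y
      show "(\<lambda>n. ?p n y) \<longlonglongrightarrow> 0"
      proof (cases "y \<in> C")
        case False
        have "(\<lambda>n. y - s n *\<^sub>R w) \<longlonglongrightarrow> y - 0 *\<^sub>R w" by (intro tendsto_intros s)
        then have "(\<lambda>n. y - s n *\<^sub>R w) \<longlonglongrightarrow> y" by simp
        moreover have "open (- C)" "y \<in> - C" using C False compact_imp_closed by auto
        ultimately have "\<forall>\<^sub>F n in sequentially. y - s n *\<^sub>R w \<in> - C" by (rule topological_tendstoD)
        then have "\<forall>\<^sub>F n in sequentially. ?p n y = 0" by eventually_elim (use False in auto)
        then show ?thesis by (rule tendsto_eventually)
      next
        case True
        then have "?p n y = 0" for n by (auto simp: indicator_def)
        then show ?thesis by simp
      qed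
    qed
    show "AE y in lborel. norm (?p n y) \<le> indicator ?D y" for n
    proof (rule AE_I2)
      fix y
      have "norm y \<le> r + norm w" if "y - s n *\<^sub>R w \<in> C"
      proof -
        have "norm (y - s n *\<^sub>R w) \<le> r" using that r by auto
        moreover have "norm (s n *\<^sub>R w) \<le> 1 * norm w"
          unfolding norm_scaleR using s(2) by (intro mult_right_mono) auto
        moreover have "norm y \<le> norm (y - s n *\<^sub>R w) + norm (s n *\<^sub>R w)"
          using norm_triangle_ineq[of "y - s n *\<^sub>R w" "s n *\<^sub>R w"] by simp
        ultimately show ?thesis by linarith
      qed
      then show "norm (?p n y) \<le> indicator ?D y" by (auto simp: indicator_def)
    qed
  qed (use intD in auto)
  then have p0: "(\<lambda>n. integral\<^sup>L lborel (?p n)) \<longlonglongrightarrow> 0" by simp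
  have "(\<integral>y. \<bar>?a n y - indicator C y\<bar> \<partial>lborel) = 2 * integral\<^sup>L lborel (?p n)" for n
  proof -
    have intp: "integrable lborel (?p n)" using inta intC by auto
    have "\<bar>?a n y - indicator C y\<bar> = 2 * ?p n y - (?a n y - indicator C y)" for y
      by (simp add: max_def abs_if)
    then have "(\<integral>y. \<bar>?a n y - indicator C y\<bar> \<partial>lborel) = (\<integral>y. 2 * ?p n y - (?a n y - indicator C y) \<partial>lborel)"
      by simp
    also have "\<dots> = 2 * integral\<^sup>L lborel (?p n) - (integral\<^sup>L lborel (?a n) - integral\<^sup>L lborel (indicator C))"
      using intp inta[of n] intC
      by (subst Bochner_Integration.integral_diff) (auto simp: Bochner_Integration.integral_diff)
    also have "integral\<^sup>L lborel (?a n) = integral\<^sup>L lborel (indicator C)"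
      using lborel_integral_shift[of "indicator C" "- s n *\<^sub>R w"] by simp
    finally show ?thesis by simp
  qed
  then show ?thesis using tendsto_mult_left[OF p0, of 2] by simp
qed

text \<open>Let \<open>q\<close> be the difference quotient of \<open>f\<close> in direction \<open>u\<close> with step \<open>s\<close>. The difference quotient for
  \<open>u + w\<close> minus those for \<open>u\<close> and for \<open>w\<close> equals \<open>q(x + s w) - q(x)\<close>. In an integral over a
  compact set \<open>C\<close> the translation can be moved from the bounded function \<open>q\<close> to \<open>C\<close>, so the integral
  tends to \<open>0\<close> with \<open>s\<close>. Hence the defect of additivity has integral \<open>0\<close> over every compact set.\<close>

lemma directional_derivative_additive_AE:
  fixes f :: "'a::euclidean_space \<Rightarrow> real"
  assumes lip: "L-lipschitz_on UNIV f"
  shows "AE x in lborel. \<forall>a b c. has_directional_derivative f u x a \<longrightarrow>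
    has_directional_derivative f w x b \<longrightarrow> has_directional_derivative f (u + w) x c \<longrightarrow> c = a + b"
proof -
  have cont: "continuous_on A f" for A
    using lip lipschitz_on_continuous_on continuous_on_subset by blast
  define s where "s n = 1 / real (Suc n)" for n
  have s: "s n > 0" "\<bar>s n\<bar> \<le> 1" for n unfolding s_def by auto
  have s0: "s \<longlonglongrightarrow> 0" unfolding s_def using LIMSEQ_inverse_real_of_nat by (simp add: inverse_eq_divide)
  define q where "q u n x = (f (x + s n *\<^sub>R u) - f x) / s n" for u n x
  have q: "(\<lambda>n. q u n x) \<longlonglongrightarrow> l" if "has_directional_derivative f u x l" for u x l
  proof -
    have "((\<lambda>h. (f (x + h *\<^sub>R u) - f x) / h) \<longlongrightarrow> l) (at 0)" using that unfolding DERIV_def by simp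
    moreover have "filterlim s (at 0) sequentially"
      using s s0 by (auto simp: filterlim_at intro!: always_eventually) (metis less_irrefl)
    ultimately show ?thesis unfolding q_def by (rule filterlim_compose)
  qed
  have contq: "continuous_on UNIV (q u n)" for u n
    unfolding q_def using s(1)[of n] by (intro continuous_intros continuous_on_compose2[OF cont]) auto
  then have mq[measurable]: "q u n \<in> borel_measurable borel" for u n
    by (rule borel_measurable_continuous_onI)
  have bq: "\<bar>q u n x\<bar> \<le> L * norm u" for u n x
  proof -
    have "dist (f (x + s n *\<^sub>R u)) (f x) \<le> L * dist (x + s n *\<^sub>R u) x"
      by (rule lipschitz_onD[OF lip]) auto
    then have "\<bar>f (x + s n *\<^sub>R u) - f x\<bar> \<le> L * norm u * s n"
      using s(1)[of n] by (simp add: dist_norm mult_ac)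
    then show ?thesis unfolding q_def using s(1)[of n] by (simp add: divide_le_eq)
  qed
  define g where "g x = lim (\<lambda>n. q (u + w) n x - q u n x - q w n x)" for x
  have gm[measurable]: "g \<in> borel_measurable borel" unfolding g_def by measurable
  \<comment> \<open>Truncating the limit changes it on a null set only and makes it bounded at every point.\<close>
  define h where "h x = max (- (L * norm (u + w) + L * norm u + L * norm w)) (min (L * norm (u + w) + L * norm u + L * norm w) (g x))" for x
  have hm[measurable]: "h \<in> borel_measurable borel" unfolding h_def by measurable
  have L: "L \<ge> 0" using lip lipschitz_on_nonneg by blast
  let ?B = "L * norm (u + w) + L * norm u + L * norm w"
  have B: "\<bar>q (u + w) n x - q u n x - q w n x\<bar> \<le> ?B" for n x
    using bq[of "u + w" n x] bq[of u n x] bq[of w n x] by linarith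
  have lim: "AE x in lborel. (\<lambda>n. q (u + w) n x - q u n x - q w n x) \<longlonglongrightarrow> h x"
    using directional_derivative_exists_AE[OF lip, of u] directional_derivative_exists_AE[OF lip, of w]
      directional_derivative_exists_AE[OF lip, of "u + w"]
  proof eventually_elim
    case (elim x)
    then obtain a b c where abc: "(\<lambda>n. q u n x) \<longlonglongrightarrow> a" "(\<lambda>n. q w n x) \<longlonglongrightarrow> b" "(\<lambda>n. q (u + w) n x) \<longlonglongrightarrow> c"
      using q by blast
    have l: "(\<lambda>n. q (u + w) n x - q u n x - q w n x) \<longlonglongrightarrow> c - a - b" by (intro tendsto_intros abc)
    then have "g x = c - a - b" unfolding g_def by (rule limI)
    moreover have "\<bar>c - a - b\<bar> \<le> ?B"
      by (rule LIMSEQ_le_const2[OF tendsto_rabs[OF l]]) (use B in auto)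
    ultimately have "h x = c - a - b" unfolding h_def by (auto simp: max_def min_def)
    then show ?case using l by simp
  qed
  have "AE x in lborel. h x = 0"
  proof (rule AE_zero_if_integral_compact_zero[OF hm])
    show "\<bar>h x\<bar> \<le> ?B" for x
    proof -
      have "0 \<le> ?B" using L by simp
      then show ?thesis unfolding h_def by (simp add: max_def min_def abs_le_iff)
    qed
    fix C :: "'a set" assume C: "compact C"
    then have [measurable]: "C \<in> sets borel" using compact_imp_closed borel_closed by blast
    have intC: "integrable lborel (indicator C :: 'a \<Rightarrow> real)"
      using emeasure_bounded_finite[OF compact_imp_bounded[OF C]] by simp
    let ?r = "\<lambda>n x. q (u + w) n x - q u n x - q w n x"
    have "(\<lambda>n. \<integral>x. indicator C x * ?r n x \<partial>lborel) \<longlonglongrightarrow> (\<integral>x. indicator C x * h x \<partial>lborel)"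
    proof (rule integral_dominated_convergence[where w = "\<lambda>x. ?B * indicator C x"])
      show "AE x in lborel. (\<lambda>n. indicator C x * ?r n x) \<longlonglongrightarrow> indicator C x * h x"
        using lim by eventually_elim (intro tendsto_intros)
      show "AE x in lborel. norm (indicator C x * ?r n x) \<le> ?B * indicator C x" for n
        using B[of n] by (intro AE_I2) (auto simp: indicator_def)
    qed (use intC in auto)
    moreover have "(\<lambda>n. \<integral>x. indicator C x * ?r n x \<partial>lborel) \<longlonglongrightarrow> 0"
    proof (rule Lim_null_comparison)
      show "(\<lambda>n. (L * norm u) * (\<integral>y. \<bar>indicator C (y - s n *\<^sub>R w) - indicator C y\<bar> \<partial>lborel)) \<longlonglongrightarrow> 0"
        by (intro tendsto_mult_right_zero indicator_compact_translate_L1 C s0 s)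
      show "\<forall>\<^sub>F n in sequentially. norm (\<integral>x. indicator C x * ?r n x \<partial>lborel)
          \<le> (L * norm u) * (\<integral>y. \<bar>indicator C (y - s n *\<^sub>R w) - indicator C y\<bar> \<partial>lborel)"
      proof (intro always_eventually allI)
        fix n
        let ?d = "\<lambda>y. indicator C (y - s n *\<^sub>R w) :: real"
        have intd: "integrable lborel ?d"
          using lborel_integrable_shift[OF intC, of "- s n *\<^sub>R w"] by simp
        have bd: "integrable lborel (\<lambda>y. e y * q u n y)" if e: "integrable lborel e" for e
        proof (rule Bochner_Integration.integrable_bound)
          show "integrable lborel (\<lambda>y. (L * norm u) * e y)" using e by simp
          show "AE y in lborel. norm (e y * q u n y) \<le> norm ((L * norm u) * e y)"
            using bq[of u n] L by (intro AE_I2) (auto simp: abs_mult mult.commute intro: mult_left_mono)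
        qed (use e in measurable)
        have eq: "?r n x = q u n (x + s n *\<^sub>R w) - q u n x" for x
          unfolding q_def using s(1)[of n] by (simp add: field_simps scaleR_add_right add_ac)
        have i2: "integrable lborel (\<lambda>x. indicator C x * q u n (x + s n *\<^sub>R w))"
          using lborel_integrable_shift[OF bd[OF intd], of "s n *\<^sub>R w"] by simp
        have "(\<integral>x. indicator C x * ?r n x \<partial>lborel)
            = (\<integral>x. indicator C x * q u n (x + s n *\<^sub>R w) - indicator C x * q u n x \<partial>lborel)"
          unfolding eq by (simp add: right_diff_distrib)
        also have "\<dots> = (\<integral>x. indicator C x * q u n (x + s n *\<^sub>R w) \<partial>lborel) - (\<integral>x. indicator C x * q u n x \<partial>lborel)"
          by (rule Bochner_Integration.integral_diff[OF i2 bd[OF intC]])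
        also have "(\<integral>x. indicator C x * q u n (x + s n *\<^sub>R w) \<partial>lborel) = (\<integral>y. ?d y * q u n y \<partial>lborel)"
          using lborel_integral_shift[of "\<lambda>y. ?d y * q u n y" "s n *\<^sub>R w"] by simp
        also have "\<dots> - (\<integral>x. indicator C x * q u n x \<partial>lborel) = (\<integral>y. ?d y * q u n y - indicator C y * q u n y \<partial>lborel)"
          by (rule Bochner_Integration.integral_diff[OF bd[OF intd] bd[OF intC], symmetric])
        also have "norm \<dots> \<le> (\<integral>y. (L * norm u) * \<bar>?d y - indicator C y\<bar> \<partial>lborel)"
        proof (rule order_trans[OF integral_norm_bound Bochner_Integration.integral_mono])
          show "norm (?d y * q u n y - indicator C y * q u n y) \<le> (L * norm u) * \<bar>?d y - indicator C y\<bar>" for y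
            using mult_right_mono[OF bq[of u n y], of "\<bar>?d y - indicator C y\<bar>"]
            by (simp add: abs_mult[symmetric] algebra_simps)
        qed (use bd[OF intd] bd[OF intC] intd intC in auto)
        finally show "norm (\<integral>x. indicator C x * ?r n x \<partial>lborel)
          \<le> (L * norm u) * (\<integral>y. \<bar>indicator C (y - s n *\<^sub>R w) - indicator C y\<bar> \<partial>lborel)" by simp
      qed
    qed
    ultimately show "(\<integral>x. indicator C x * h x \<partial>lborel) = 0" by (rule LIMSEQ_unique)
  qed
  then show ?thesis using lim
  proof eventually_elim
    case (elim x)
    show ?case
    proof (intro allI impI)
      fix a b c assume "has_directional_derivative f u x a" "has_directional_derivative f w x b"
        "has_directional_derivative f (u + w) x c"
      then have "(\<lambda>n. q (u + w) n x - q u n x - q w n x) \<longlonglongrightarrow> c - a - b" by (intro tendsto_intros q)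
      then have "c - a - b = 0" using elim by (metis LIMSEQ_unique)
      then show "c = a + b" by simp
    qed
  qed
qed

section \<open>Rademacher's theorem\<close>

definition rational_vectors :: "'a::euclidean_space set" where
  "rational_vectors = {x. \<forall>b\<in>Basis. x \<bullet> b \<in> \<rat>}"

lemma countable_rational_vectors: "countable (rational_vectors :: 'a::euclidean_space set)"
proof -
  have "(rational_vectors :: 'a set) \<subseteq> (\<lambda>c. \<Sum>b\<in>Basis. c b *\<^sub>R b) ` (Basis \<rightarrow>\<^sub>E \<rat>)"
  proof
    fix x :: 'a assume "x \<in> rational_vectors"
    then have "restrict (\<lambda>b. x \<bullet> b) Basis \<in> Basis \<rightarrow>\<^sub>E \<rat>" unfolding rational_vectors_def by auto
    moreover have "x = (\<Sum>b\<in>Basis. restrict (\<lambda>b. x \<bullet> b) Basis b *\<^sub>R b)" by (simp add: euclidean_representation)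
    ultimately show "x \<in> (\<lambda>c. \<Sum>b\<in>Basis. c b *\<^sub>R b) ` (Basis \<rightarrow>\<^sub>E \<rat>)" by blast
  qed
  moreover have "countable (Basis \<rightarrow>\<^sub>E (\<rat> :: real set) :: ('a \<Rightarrow> real) set)"
    by (intro countable_PiE countable_rat) auto
  ultimately show ?thesis by (meson countable_image countable_subset)
qed

lemma rational_vectors_dense:
  fixes x :: "'a::euclidean_space"
  assumes "e > 0" shows "\<exists>z\<in>rational_vectors. x \<in> ball z e"
proof -
  obtain a b where ab: "\<forall>i\<in>Basis. a \<bullet> i \<in> \<rat> \<and> b \<bullet> i \<in> \<rat>" "x \<in> cbox a b" "cbox a b \<subseteq> ball x e"
    using rational_cboxes[OF assms, of x] by blast
  then have "a \<in> ball x e" by (meson box_ne_empty(1) empty_iff mem_box(2) subsetD in_mono order_refl order_trans)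
  then show ?thesis using ab(1) unfolding rational_vectors_def by (auto simp: dist_commute)
qed

text \<open>Additivity makes the directional derivative a linear function \<open>l\<close> on rational vectors. Finitely many
  rational vectors come close to every unit vector. On their rays the difference quotients converge to
  \<open>l\<close> uniformly, and Lipschitz continuity carries this over to all directions.\<close>

lemma differentiable_if_rational_directional_derivatives:
  fixes f :: "'a::euclidean_space \<Rightarrow> real"
  assumes lip: "L-lipschitz_on UNIV f"
    and ex: "\<And>u. u \<in> rational_vectors \<Longrightarrow> has_directional_derivative f u x (D u)"
    and add: "\<And>u w. u \<in> rational_vectors \<Longrightarrow> w \<in> rational_vectors \<Longrightarrow> D (u + w) = D u + D w"
  shows "f differentiable (at x)"
proof -
  have hom: "D (c *\<^sub>R u) = c * D u" if "u \<in> rational_vectors" "c \<in> \<rat>" for u c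
  proof -
    have cu: "c *\<^sub>R u \<in> rational_vectors" using that unfolding rational_vectors_def by auto
    have "((\<lambda>t. f (x + (c * t) *\<^sub>R u)) has_field_derivative D u * c) (at 0)"
      by (rule DERIV_chain'[where f = "\<lambda>t. c * t" and g = "\<lambda>t. f (x + t *\<^sub>R u)"])
        (auto intro!: derivative_eq_intros ex[OF that(1)])
    then have "has_directional_derivative f (c *\<^sub>R u) x (D u * c)" by (simp add: mult.commute)
    then show ?thesis using DERIV_unique[OF ex[OF cu]] by simp
  qed
  have bas: "b \<in> rational_vectors" if "b \<in> Basis" for b :: 'a
    using that unfolding rational_vectors_def by (auto simp: inner_Basis)
  have zero: "0 \<in> (rational_vectors :: 'a set)" unfolding rational_vectors_def by auto
  define l where "l y = (\<Sum>b\<in>Basis. (y \<bullet> b) * D b)" for y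
  have Dl: "D u = l u" if u: "u \<in> rational_vectors" for u
  proof -
    have "D (\<Sum>b\<in>S. (u \<bullet> b) *\<^sub>R b) = (\<Sum>b\<in>S. (u \<bullet> b) * D b) \<and> (\<Sum>b\<in>S. (u \<bullet> b) *\<^sub>R b) \<in> rational_vectors"
      if "finite S" "S \<subseteq> Basis" for S
      using that
    proof (induction S rule: finite_induct)
      case empty
      have "D 0 = 0" using add[OF zero zero] by simp
      then show ?case using zero by simp
    next
      case (insert b S)
      have r: "u \<bullet> b \<in> \<rat>" using u insert.prems unfolding rational_vectors_def by auto
      have b: "b \<in> rational_vectors" using bas insert.prems by auto
      have cb: "(u \<bullet> b) *\<^sub>R b \<in> rational_vectors" using r b unfolding rational_vectors_def by auto
      have IH: "D (\<Sum>b\<in>S. (u \<bullet> b) *\<^sub>R b) = (\<Sum>b\<in>S. (u \<bullet> b) * D b)" "(\<Sum>b\<in>S. (u \<bullet> b) *\<^sub>R b) \<in> rational_vectors"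
        using insert by auto
      have "(u \<bullet> b) *\<^sub>R b + (\<Sum>b\<in>S. (u \<bullet> b) *\<^sub>R b) \<in> rational_vectors"
        using cb IH(2) unfolding rational_vectors_def by (auto simp: inner_add_left)
      then show ?case using add[OF cb IH(2)] hom[OF b r] IH(1) insert.hyps by simp
    qed
    from this[of Basis] show ?thesis unfolding l_def by (simp add: euclidean_representation)
  qed
  have "bounded_linear l" unfolding l_def
    by (intro bounded_linear_sum bounded_linear_mult_left[THEN bounded_linear_compose] bounded_linear_inner_left)
  then interpret l: bounded_linear l .
  obtain M where M: "M > 0" "\<And>y. \<bar>l y\<bar> \<le> M * norm y"
    using l.pos_bounded by (auto simp: mult.commute)
  have L: "L \<ge> 0" using lip lipschitz_on_nonneg by blast
  have "(f has_derivative l) (at x)"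
    unfolding has_derivative_at_alt
  proof (intro conjI allI impI)
    fix e :: real assume e: "0 < e"
    define \<eta> where "\<eta> = e / (L + M + 1)"
    have \<eta>: "\<eta> > 0" "(L + M + 1) * \<eta> = e" unfolding \<eta>_def using e L M(1) by auto
    have "sphere (0::'a) 1 \<subseteq> (\<Union>z\<in>rational_vectors. ball z \<eta>)"
      using rational_vectors_dense[OF \<eta>(1)] by blast
    then obtain Z where Z: "Z \<subseteq> rational_vectors" "finite Z" "sphere (0::'a) 1 \<subseteq> (\<Union>z\<in>Z. ball z \<eta>)"
      using compactE_image[OF compact_sphere, of rational_vectors "\<lambda>z. ball z \<eta>" "0::'a" 1] by blast
    have "\<forall>z\<in>Z. \<exists>\<delta>>0. \<forall>t. 0 < t \<and> t < \<delta> \<longrightarrow> \<bar>f (x + t *\<^sub>R z) - f x - t * l z\<bar> \<le> \<eta> * t"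
    proof
      fix z assume "z \<in> Z"
      then have z: "z \<in> rational_vectors" using Z by auto
      have "((\<lambda>h. (f (x + h *\<^sub>R z) - f x) / h) \<longlongrightarrow> l z) (at 0)"
        using ex[OF z] unfolding DERIV_def Dl[OF z] by simp
      then have "\<forall>\<^sub>F h in at 0. dist ((f (x + h *\<^sub>R z) - f x) / h) (l z) < \<eta>"
        using \<eta>(1) by (rule tendstoD)
      then obtain \<delta> where \<delta>: "\<delta> > 0" "\<And>h. h \<noteq> 0 \<Longrightarrow> \<bar>h\<bar> < \<delta> \<Longrightarrow> \<bar>(f (x + h *\<^sub>R z) - f x) / h - l z\<bar> < \<eta>"
        unfolding eventually_at by (auto simp: dist_real_def)
      have "\<bar>f (x + t *\<^sub>R z) - f x - t * l z\<bar> \<le> \<eta> * t" if "0 < t \<and> t < \<delta>" for t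
      proof -
        have "f (x + t *\<^sub>R z) - f x - t * l z = t * ((f (x + t *\<^sub>R z) - f x) / t - l z)"
          using that by (simp add: field_simps)
        then show ?thesis using \<delta>(2)[of t] that by (simp add: abs_mult mult.commute)
      qed
      then show "\<exists>\<delta>>0. \<forall>t. 0 < t \<and> t < \<delta> \<longrightarrow> \<bar>f (x + t *\<^sub>R z) - f x - t * l z\<bar> \<le> \<eta> * t"
        using \<delta>(1) by blast
    qed
    then obtain \<delta> where \<delta>: "\<And>z. z \<in> Z \<Longrightarrow> \<delta> z > 0"
      "\<And>z t. z \<in> Z \<Longrightarrow> 0 < t \<Longrightarrow> t < \<delta> z \<Longrightarrow> \<bar>f (x + t *\<^sub>R z) - f x - t * l z\<bar> \<le> \<eta> * t"
      by metis
    define d where "d = Min (insert 1 (\<delta> ` Z))"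
    have d: "d > 0" "\<And>z. z \<in> Z \<Longrightarrow> d \<le> \<delta> z"
      unfolding d_def using Z(2) \<delta>(1) by auto
    have "norm (f y - f x - l (y - x)) \<le> e * norm (y - x)" if y: "norm (y - x) < d" for y
    proof (cases "y = x")
      case True
      then show ?thesis by (simp add: l.zero)
    next
      case False
      define t where "t = norm (y - x)"
      define \<sigma> where "\<sigma> = (1 / t) *\<^sub>R (y - x)"
      have t: "t > 0" "t < d" using False y unfolding t_def by auto
      have y_eq: "y = x + t *\<^sub>R \<sigma>" unfolding \<sigma>_def using t by simp
      have "norm \<sigma> = 1" unfolding \<sigma>_def using t t_def by simp
      then obtain z where z: "z \<in> Z" "dist z \<sigma> < \<eta>" using Z(3) by fastforce
      have 1: "\<bar>f (x + t *\<^sub>R z) - f x - t * l z\<bar> \<le> \<eta> * t"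
        using \<delta>(2)[OF z(1) t(1)] d(2)[OF z(1)] t(2) by simp
      have "dist (f (x + t *\<^sub>R \<sigma>)) (f (x + t *\<^sub>R z)) \<le> L * dist (x + t *\<^sub>R \<sigma>) (x + t *\<^sub>R z)"
        by (rule lipschitz_onD[OF lip]) auto
      also have "dist (x + t *\<^sub>R \<sigma>) (x + t *\<^sub>R z) = t * dist z \<sigma>"
        using t(1) by (simp add: dist_norm norm_minus_commute flip: scaleR_diff_right)
      also have "L * (t * dist z \<sigma>) \<le> L * (t * \<eta>)" using L t z by (intro mult_left_mono) auto
      finally have 2: "\<bar>f (x + t *\<^sub>R \<sigma>) - f (x + t *\<^sub>R z)\<bar> \<le> L * \<eta> * t" by (simp add: dist_real_def mult_ac)
      have "\<bar>l (z - \<sigma>)\<bar> \<le> M * norm (z - \<sigma>)" by (rule M(2))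
      also have "\<dots> \<le> M * \<eta>" using z M(1) by (auto simp: dist_norm)
      finally have "\<bar>t * l z - t * l \<sigma>\<bar> \<le> M * \<eta> * t"
        using t(1) by (simp add: l.diff abs_mult mult.commute flip: right_diff_distrib)
      moreover have "l (y - x) = t * l \<sigma>" unfolding y_eq by (simp add: l.scaleR)
      ultimately have "\<bar>f y - f x - l (y - x)\<bar> \<le> \<eta> * t + L * \<eta> * t + M * \<eta> * t"
        using 1 2 unfolding y_eq by linarith
      also have "\<dots> = (L + M + 1) * \<eta> * t" by (simp add: algebra_simps)
      finally show ?thesis unfolding \<eta>(2) t_def by simp
    qed
    then show "\<exists>d>0. \<forall>y. norm (y - x) < d \<longrightarrow> norm (f y - f x - l (y - x)) \<le> e * norm (y - x)"
      using d(1) by blast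
  qed (rule \<open>bounded_linear l\<close>)
  then show ?thesis unfolding differentiable_def by blast
qed

theorem rademacher_real:
  fixes f :: "'a::euclidean_space \<Rightarrow> real"
  assumes lip: "L-lipschitz_on UNIV f"
  shows "AE x in lborel. f differentiable (at x)"
proof -
  have "AE x in lborel. \<forall>u\<in>rational_vectors. \<exists>l. has_directional_derivative f u x l"
    by (rule AE_ball_countable'[OF _ countable_rational_vectors]) (rule directional_derivative_exists_AE[OF lip])
  moreover have "AE x in lborel. \<forall>u\<in>rational_vectors. \<forall>w\<in>rational_vectors. \<forall>a b c. has_directional_derivative f u x a \<longrightarrow>
    has_directional_derivative f w x b \<longrightarrow> has_directional_derivative f (u + w) x c \<longrightarrow> c = a + b"
    by (intro AE_ball_countable'[OF _ countable_rational_vectors]) (rule directional_derivative_additive_AE[OF lip])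
  ultimately show ?thesis
  proof eventually_elim
    case (elim x)
    from elim(1) obtain D where D: "\<And>u. u \<in> rational_vectors \<Longrightarrow> has_directional_derivative f u x (D u)" by metis
    show ?case
    proof (rule differentiable_if_rational_directional_derivatives[OF lip D])
      fix u w :: 'a assume uw: "u \<in> rational_vectors" "w \<in> rational_vectors"
      then have "u + w \<in> rational_vectors" unfolding rational_vectors_def by (auto simp: inner_add_left)
      then show "D (u + w) = D u + D w" using elim(2) uw D by blast
    qed
  qed
qed

text \<open>McShane's extension: the lower envelope of the cones of slope \<open>L\<close> that stand on the graph of \<open>f\<close>.\<close>

lemma lipschitz_extension_real:
  fixes f :: "'a::metric_space \<Rightarrow> real"
  assumes lip: "L-lipschitz_on U f" and "U \<noteq> {}"
  obtains F where "L-lipschitz_on UNIV F" "\<And>x. x \<in> U \<Longrightarrow> F x = f x"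
proof -
  define F where "F x = (INF y\<in>U. f y + L * dist x y)" for x
  have L: "L \<ge> 0" using lip lipschitz_on_nonneg by blast
  obtain z where z: "z \<in> U" using \<open>U \<noteq> {}\<close> by blast
  have bdd: "bdd_below ((\<lambda>y. f y + L * dist x y) ` U)" for x
  proof (rule bdd_belowI2)
    fix y assume y: "y \<in> U"
    have "f z - f y \<le> L * dist z y" using lipschitz_onD[OF lip z y] by (simp add: dist_real_def)
    also have "\<dots> \<le> L * (dist x z + dist x y)" using L dist_triangle3[of z y x] by (intro mult_left_mono) auto
    finally show "f z - L * dist x z \<le> f y + L * dist x y" by (simp add: algebra_simps)
  qed
  have step: "F x \<le> F x' + L * dist x x'" for x x'
  proof -
    have "F x - L * dist x x' \<le> F x'" unfolding F_def[of x']
    proof (rule cINF_greatest[OF \<open>U \<noteq> {}\<close>])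
      fix y assume y: "y \<in> U"
      have "F x \<le> f y + L * dist x y" unfolding F_def by (rule cINF_lower[OF bdd y])
      also have "L * dist x y \<le> L * (dist x x' + dist x' y)" using L dist_triangle by (intro mult_left_mono) auto
      finally show "F x - L * dist x x' \<le> f y + L * dist x' y" by (simp add: algebra_simps)
    qed
    then show ?thesis by simp
  qed
  have "L-lipschitz_on UNIV F"
  proof (rule lipschitz_onI[OF _ L])
    show "dist (F x) (F y) \<le> L * dist x y" for x y
      using step[of x y] step[of y x] by (simp add: dist_real_def dist_commute abs_le_iff)
  qed
  moreover have "F x = f x" if x: "x \<in> U" for x
  proof (rule antisym)
    show "F x \<le> f x" unfolding F_def using cINF_lower[OF bdd[of x] x] by simp
    show "f x \<le> F x" unfolding F_def
    proof (rule cINF_greatest[OF \<open>U \<noteq> {}\<close>])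
      show "f x \<le> f y + L * dist x y" if "y \<in> U" for y
        using lipschitz_onD[OF lip x that] by (simp add: dist_real_def)
    qed
  qed
  ultimately show thesis by (rule that)
qed

theorem rademacher:
  fixes f :: "'a::euclidean_space \<Rightarrow> 'b::euclidean_space"
  assumes lip: "L-lipschitz_on U f" and U: "open U"
  shows "AE x in lborel. x \<in> U \<longrightarrow> f differentiable (at x)"
proof (cases "U = {}")
  case False
  have "AE x in lborel. x \<in> U \<longrightarrow> (\<lambda>y. f y \<bullet> b) differentiable (at x)" if b: "b \<in> Basis" for b
  proof -
    have "L-lipschitz_on U (\<lambda>y. f y \<bullet> b)"
    proof (rule lipschitz_onI)
      show "dist (f x \<bullet> b) (f y \<bullet> b) \<le> L * dist x y" if "x \<in> U" "y \<in> U" for x y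
      proof -
        have "dist (f x \<bullet> b) (f y \<bullet> b) \<le> dist (f x) (f y)"
          using Basis_le_norm[OF b, of "f x - f y"] by (simp add: dist_norm inner_diff_left)
        also have "\<dots> \<le> L * dist x y" using lipschitz_onD[OF lip that] .
        finally show ?thesis .
      qed
    qed (use lipschitz_on_nonneg[OF lip] in simp)
    then obtain F where F: "L-lipschitz_on UNIV F" "\<And>x. x \<in> U \<Longrightarrow> F x = f x \<bullet> b"
      using lipschitz_extension_real False by blast
    from rademacher_real[OF F(1)] show ?thesis
    proof eventually_elim
      case (elim x)
      show ?case
      proof
        assume x: "x \<in> U"
        obtain D where D: "(F has_derivative D) (at x)" using elim unfolding differentiable_def by blast
        have "((\<lambda>y. f y \<bullet> b) has_derivative D) (at x)"
          by (rule has_derivative_transform_within_open[OF D U x]) (simp add: F(2))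
        then show "(\<lambda>y. f y \<bullet> b) differentiable (at x)" unfolding differentiable_def by blast
      qed
    qed
  qed
  then have "AE x in lborel. \<forall>b\<in>Basis. x \<in> U \<longrightarrow> (\<lambda>y. f y \<bullet> b) differentiable (at x)"
    by (intro AE_finite_allI) auto
  then show ?thesis
    by eventually_elim (use differentiable_componentwise_within in blast)
qed simp

section \<open>Symmetry of second derivatives\<close>

text \<open>By the mean value theorem in direction \<open>h\<close> the second difference is \<open>t\<close> times an increment of \<open>G _ h\<close>
  between two points that differ by \<open>t k\<close>. Differentiability of \<open>G _ h\<close> at the single point \<open>x\<close>
  suffices to compare this increment with \<open>t H k\<close>.\<close>

lemma second_difference_limit:
  fixes f :: "'a::euclidean_space \<Rightarrow> real"
  assumes U: "open U" "x \<in> U" and f: "\<And>y. y \<in> U \<Longrightarrow> (f has_derivative G y) (at y)"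
    and H: "((\<lambda>y. G y h) has_derivative H) (at x)"
  shows "((\<lambda>t. (f (x + t *\<^sub>R h + t *\<^sub>R k) - f (x + t *\<^sub>R h) - f (x + t *\<^sub>R k) + f x) / t\<^sup>2) \<longlongrightarrow> H k) (at_right 0)"
proof (rule tendstoI)
  fix e :: real assume e: "0 < e"
  define n where "n = norm h + norm k + 1"
  have n: "n > 0" unfolding n_def by (simp add: add_nonneg_pos)
  define \<eta> where "\<eta> = e / (4 * n)"
  have \<eta>: "\<eta> > 0" "4 * n * \<eta> = e" unfolding \<eta>_def using e n by auto
  interpret H: bounded_linear H using H by (rule has_derivative_bounded_linear)
  obtain \<delta>1 where \<delta>1: "\<delta>1 > 0" "\<And>y. norm (y - x) < \<delta>1 \<Longrightarrow> norm (G y h - G x h - H (y - x)) \<le> \<eta> * norm (y - x)"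
    using H \<eta>(1) unfolding has_derivative_at_alt by blast
  obtain \<delta>2 where \<delta>2: "\<delta>2 > 0" "ball x \<delta>2 \<subseteq> U" using U open_contains_ball by blast
  define d where "d = min \<delta>1 \<delta>2 / n"
  have d: "d > 0" unfolding d_def using \<delta>1 \<delta>2 n by simp
  have "dist ((f (x + t *\<^sub>R h + t *\<^sub>R k) - f (x + t *\<^sub>R h) - f (x + t *\<^sub>R k) + f x) / t\<^sup>2) (H k) < e"
    if t: "0 < t" "t < d" for t
  proof -
    have small: "norm (s *\<^sub>R h + c *\<^sub>R k) \<le> t * n" "norm (s *\<^sub>R h + c *\<^sub>R k) < min \<delta>1 \<delta>2"
      if "0 \<le> s" "s \<le> t" "0 \<le> c" "c \<le> t" for s c
    proof -
      have "norm (s *\<^sub>R h + c *\<^sub>R k) \<le> s * norm h + c * norm k"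
        using norm_triangle_ineq[of "s *\<^sub>R h" "c *\<^sub>R k"] that by simp
      also have "\<dots> \<le> t * norm h + t * norm k" using that by (intro add_mono mult_right_mono) auto
      also have "\<dots> \<le> t * n" unfolding n_def using t by (simp add: algebra_simps)
      finally show 1: "norm (s *\<^sub>R h + c *\<^sub>R k) \<le> t * n" .
      have "t * n < min \<delta>1 \<delta>2" using t n unfolding d_def by (simp add: pos_less_divide_eq)
      then show "norm (s *\<^sub>R h + c *\<^sub>R k) < min \<delta>1 \<delta>2" using 1 by linarith
    qed
    have inU: "x + (s *\<^sub>R h + c *\<^sub>R k) \<in> U" if "0 \<le> s" "s \<le> t" "0 \<le> c" "c \<le> t" for s c
    proof -
      have "norm (x - (x + (s *\<^sub>R h + c *\<^sub>R k))) < \<delta>2"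
        using small(2)[OF that] by (subst norm_minus_commute) simp
      then have "x + (s *\<^sub>R h + c *\<^sub>R k) \<in> ball x \<delta>2" by (simp only: mem_ball dist_norm)
      then show ?thesis using \<delta>2(2) by blast
    qed
    have der: "((\<lambda>s. f (x + (s *\<^sub>R h + c *\<^sub>R k))) has_real_derivative G (x + (s *\<^sub>R h + c *\<^sub>R k)) h) (at s)"
      if "0 \<le> s" "s \<le> t" "0 \<le> c" "c \<le> t" for s c
    proof -
      have "((\<lambda>s. x + (s *\<^sub>R h + c *\<^sub>R k)) has_derivative (\<lambda>r. r *\<^sub>R h)) (at s)"
        by (auto intro!: derivative_eq_intros)
      from has_derivative_compose[OF this f[OF inU[OF that]]]
      have "((\<lambda>s. f (x + (s *\<^sub>R h + c *\<^sub>R k))) has_derivative (\<lambda>r. G (x + (s *\<^sub>R h + c *\<^sub>R k)) (r *\<^sub>R h))) (at s)" .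
      moreover have "linear (G (x + (s *\<^sub>R h + c *\<^sub>R k)))" using f[OF inU[OF that]] by (rule has_derivative_linear)
      then have "(\<lambda>r. G (x + (s *\<^sub>R h + c *\<^sub>R k)) (r *\<^sub>R h)) = (*) (G (x + (s *\<^sub>R h + c *\<^sub>R k)) h)"
        by (intro ext) (simp add: linear_cmul)
      ultimately show ?thesis unfolding has_field_derivative_def by simp
    qed
    let ?\<phi> = "\<lambda>s. f (x + (s *\<^sub>R h + t *\<^sub>R k)) - f (x + (s *\<^sub>R h + 0 *\<^sub>R k))"
    have "\<exists>z>0. z < t \<and> ?\<phi> t - ?\<phi> 0 = (t - 0) * (G (x + (z *\<^sub>R h + t *\<^sub>R k)) h - G (x + (z *\<^sub>R h + 0 *\<^sub>R k)) h)"
      by (rule MVT2[OF t(1)]) (intro DERIV_diff der; use t in simp)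
    then obtain z where z: "0 < z" "z < t"
      "?\<phi> t - ?\<phi> 0 = t * (G (x + (z *\<^sub>R h + t *\<^sub>R k)) h - G (x + (z *\<^sub>R h + 0 *\<^sub>R k)) h)" by auto
    have est: "norm (G (x + (z *\<^sub>R h + c *\<^sub>R k)) h - G x h - H (z *\<^sub>R h + c *\<^sub>R k)) \<le> \<eta> * (t * n)"
      if "0 \<le> c" "c \<le> t" for c
    proof -
      have "norm (G (x + (z *\<^sub>R h + c *\<^sub>R k)) h - G x h - H (z *\<^sub>R h + c *\<^sub>R k)) \<le> \<eta> * norm (z *\<^sub>R h + c *\<^sub>R k)"
        using \<delta>1(2)[of "x + (z *\<^sub>R h + c *\<^sub>R k)"] small(2)[of z c] z that by simp
      also have "\<dots> \<le> \<eta> * (t * n)" using \<eta>(1) small(1)[of z c] z that by (intro mult_left_mono) auto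
      finally show ?thesis .
    qed
    let ?g = "G (x + (z *\<^sub>R h + t *\<^sub>R k)) h - G (x + (z *\<^sub>R h + 0 *\<^sub>R k)) h"
    have "\<bar>?g - t * H k\<bar> \<le> 2 * (\<eta> * (t * n))"
      using est[of t] est[of 0] t by (simp add: H.add H.scaleR)
    also have "\<dots> = t * (2 * n * \<eta>)" by simp
    also have "\<dots> < t * e" using \<eta> t e by simp
    finally have "\<bar>?g / t - H k\<bar> < e" using t by (simp add: divide_simps abs_less_iff algebra_simps)
    moreover have "f (x + t *\<^sub>R h + t *\<^sub>R k) - f (x + t *\<^sub>R h) - (f (x + t *\<^sub>R k) - f x) = t * ?g"
      using z(3) by (simp add: add.assoc)
    then have "f (x + t *\<^sub>R h + t *\<^sub>R k) - f (x + t *\<^sub>R h) - f (x + t *\<^sub>R k) + f x = t * ?g"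
      by linarith
    then have "(f (x + t *\<^sub>R h + t *\<^sub>R k) - f (x + t *\<^sub>R h) - f (x + t *\<^sub>R k) + f x) / t\<^sup>2 = ?g / t"
      using t by (simp add: power2_eq_square)
    ultimately show ?thesis by (simp add: dist_real_def)
  qed
  then show "\<forall>\<^sub>F t in at_right 0. dist ((f (x + t *\<^sub>R h + t *\<^sub>R k) - f (x + t *\<^sub>R h) - f (x + t *\<^sub>R k) + f x) / t\<^sup>2) (H k) < e"
    using d unfolding eventually_at_right_field by auto
qed

text \<open>The second difference is symmetric in \<open>h\<close> and \<open>k\<close>, hence so is its limit.\<close>

lemma symmetric_second_derivative:
  fixes f :: "'a::euclidean_space \<Rightarrow> real"
  assumes U: "open U" "x \<in> U" and f: "\<And>y. y \<in> U \<Longrightarrow> (f has_derivative G y) (at y)"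
    and H: "\<And>h. ((\<lambda>y. G y h) has_derivative H h) (at x)"
  shows "H h k = H k h"
proof -
  have "((\<lambda>t. (f (x + t *\<^sub>R h + t *\<^sub>R k) - f (x + t *\<^sub>R h) - f (x + t *\<^sub>R k) + f x) / t\<^sup>2) \<longlongrightarrow> H h k) (at_right 0)"
    by (rule second_difference_limit[OF U f H])
  moreover have "((\<lambda>t. (f (x + t *\<^sub>R h + t *\<^sub>R k) - f (x + t *\<^sub>R h) - f (x + t *\<^sub>R k) + f x) / t\<^sup>2) \<longlongrightarrow> H k h) (at_right 0)"
    using second_difference_limit[OF U f H, of k h] by (simp add: algebra_simps)
  ultimately show ?thesis by (rule tendsto_unique[rotated]) simp
qed

section \<open>Differential equations on short time intervals\<close>

lemma vector_derivative_norm_bound: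
  fixes f :: "real \<Rightarrow> 'b::real_normed_vector"
  assumes "\<And>t. t \<in> closed_segment a b \<Longrightarrow> (f has_vector_derivative f' t) (at t)"
    and "\<And>t. t \<in> closed_segment a b \<Longrightarrow> norm (f' t) \<le> B"
  shows "norm (f b - f a) \<le> B * \<bar>b - a\<bar>"
proof -
  have "norm (f b - f a) \<le> B * norm (b - a)"
  proof (rule differentiable_bound[where S = "closed_segment a b" and f' = "\<lambda>t h. h *\<^sub>R f' t"])
    show "(f has_derivative (\<lambda>h. h *\<^sub>R f' t)) (at t within closed_segment a b)" if "t \<in> closed_segment a b" for t
      using assms(1)[OF that] unfolding has_vector_derivative_def by (rule has_derivative_at_withinI)
    show "onorm (\<lambda>h. h *\<^sub>R f' t) \<le> B" if "t \<in> closed_segment a b" for t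
    proof (rule onorm_le)
      show "norm (h *\<^sub>R f' t) \<le> B * norm h" for h :: real
        using mult_left_mono[OF assms(2)[OF that], of "\<bar>h\<bar>"] by (simp add: mult.commute)
    qed
  qed auto
  then show ?thesis by simp
qed

text \<open>A substitute for Gronwall's inequality. On an interval of length at most \<open>1/(2L)\<close> on either side of
  \<open>0\<close>, the term \<open>L \<bar>f\<bar>\<close> contributes at most half of the maximum of \<open>\<bar>f\<bar>\<close> and can be absorbed.\<close>

lemma short_time_bound:
  fixes f :: "real \<Rightarrow> 'b::real_normed_vector"
  assumes f: "\<And>t. \<bar>t\<bar> \<le> d \<Longrightarrow> (f has_vector_derivative f' t) (at t)"
    and f': "\<And>t. \<bar>t\<bar> \<le> d \<Longrightarrow> norm (f' t) \<le> L * norm (f t) + e"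
    and L: "0 \<le> L" "d * L \<le> 1/2" and e: "0 \<le> e" and t: "\<bar>t\<bar> \<le> d"
  shows "norm (f t) \<le> 2 * norm (f 0) + 2 * d * e"
proof -
  have d: "d \<ge> 0" using t by linarith
  have "continuous_on {-d..d} f"
    by (intro continuous_at_imp_continuous_on ballI has_vector_derivative_continuous[OF f]) auto
  then have "continuous_on {-d..d} (\<lambda>t. norm (f t))" by (rule continuous_on_norm)
  then obtain t0 where t0: "t0 \<in> {-d..d}" "\<And>s. s \<in> {-d..d} \<Longrightarrow> norm (f s) \<le> norm (f t0)"
    using continuous_attains_sup[of "{-d..d}" "\<lambda>t. norm (f t)"] d by fastforce
  define m where "m = norm (f t0)"
  have seg: "\<bar>s\<bar> \<le> d" if "s \<in> closed_segment 0 t0" for s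
    using that t0(1) by (auto simp: closed_segment_eq_real_ivl split: if_splits)
  have "norm (f t0 - f 0) \<le> (L * m + e) * \<bar>t0 - 0\<bar>"
  proof (rule vector_derivative_norm_bound)
    show "(f has_vector_derivative f' s) (at s)" if "s \<in> closed_segment 0 t0" for s using f seg that by blast
    show "norm (f' s) \<le> L * m + e" if "s \<in> closed_segment 0 t0" for s
    proof -
      have "norm (f s) \<le> m" using seg[OF that] t0(2)[of s] unfolding m_def by (simp add: abs_le_iff)
      then show ?thesis using f'[OF seg[OF that]] mult_left_mono[OF _ L(1), of "norm (f s)" m] by linarith
    qed
  qed
  also have "\<dots> \<le> (L * m + e) * d" using t0(1) L e unfolding m_def by (intro mult_left_mono) auto
  finally have "m \<le> norm (f 0) + (d * L) * m + d * e"
    using norm_triangle_ineq2[of "f t0" "f 0"] unfolding m_def by (simp add: algebra_simps)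
  also have "\<dots> \<le> norm (f 0) + 1/2 * m + d * e"
    using mult_right_mono[OF L(2), of m] unfolding m_def by simp
  finally have "m \<le> 2 * norm (f 0) + 2 * d * e" by simp
  moreover have "norm (f t) \<le> m" using t0(2)[of t] t unfolding m_def by (simp add: abs_le_iff)
  ultimately show ?thesis by linarith
qed

text \<open>The speed bound is available only while the curve is inside the ball. Up to the first time at distance
  \<open>r\<close> from \<open>x\<close> it therefore holds, and the distance covered until then is less than \<open>r/2\<close>.\<close>

lemma curve_stays_in_ball_forward:
  fixes c :: "real \<Rightarrow> 'b::euclidean_space"
  assumes c: "\<And>t. 0 \<le> t \<Longrightarrow> t \<le> d \<Longrightarrow> (c has_vector_derivative c' t) (at t)"
    and c': "\<And>t. 0 \<le> t \<Longrightarrow> t \<le> d \<Longrightarrow> c t \<in> cball x r \<Longrightarrow> norm (c' t) \<le> M"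
    and M: "0 \<le> M" "d * M < r/2" and c0: "dist x (c 0) \<le> r/2" and t: "0 \<le> t" "t \<le> d"
  shows "c t \<in> ball x r"
proof (rule ccontr)
  assume n: "c t \<notin> ball x r"
  have cont: "continuous_on {0..d} c"
    by (intro continuous_at_imp_continuous_on ballI has_vector_derivative_continuous[OF c]) auto
  let ?S = "{s \<in> {0..t}. r \<le> dist x (c s)}"
  have cont': "continuous_on {0..t} c" using t by (intro continuous_on_subset[OF cont]) auto
  have "closedin (top_of_set {0..t}) ({0..t} \<inter> (\<lambda>s. dist x (c s)) -` {r..})"
    by (intro continuous_closedin_preimage continuous_intros cont' closed_atLeast)
  moreover have "{0..t} \<inter> (\<lambda>s. dist x (c s)) -` {r..} = ?S" by auto
  ultimately have "compact ?S" using closedin_compact[of "{0..t}"] by auto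
  moreover have "t \<in> ?S" using n t by auto
  ultimately obtain s where s: "s \<in> ?S" "\<And>u. u \<in> ?S \<Longrightarrow> s \<le> u"
    using compact_attains_inf[of ?S] by blast
  have "0 \<le> d * M" using M(1) t by simp
  then have r: "r > 0" using M(2) by linarith
  have s0: "0 < s" using s c0 r by (cases "s = 0") auto
  have "\<exists>z\<in>{0<..<s}. norm (c s - c 0) \<le> norm ((s - 0) *\<^sub>R c' z)"
  proof (rule mvt_general[OF s0])
    show "continuous_on {0..s} c" by (rule continuous_on_subset[OF cont']) (use s in auto)
    show "(c has_derivative (\<lambda>h. h *\<^sub>R c' z)) (at z)" if "0 < z" "z < s" for z
      using c[of z] s t that unfolding has_vector_derivative_def by auto
  qed
  then obtain z where z: "0 < z" "z < s" "norm (c s - c 0) \<le> s * norm (c' z)" using s0 by auto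
  have "z \<notin> ?S" using s(2)[of z] z(2) by linarith
  then have "c z \<in> cball x r" using z s by auto
  then have "norm (c' z) \<le> M" using c'[of z] z s t by auto
  moreover have "s \<le> d" using s t by auto
  ultimately have "s * norm (c' z) \<le> d * M" using s0 by (intro mult_mono) auto
  then have "norm (c s - c 0) \<le> d * M" using z(3) by linarith
  then have "dist x (c s) < r" using M(2) c0 dist_triangle[of x "c s" "c 0"] by (simp add: dist_norm norm_minus_commute)
  then show False using s(1) by simp
qed

lemma curve_stays_in_ball:
  fixes c :: "real \<Rightarrow> 'b::euclidean_space"
  assumes c: "\<And>t. \<bar>t\<bar> \<le> d \<Longrightarrow> (c has_vector_derivative c' t) (at t)"
    and c': "\<And>t. \<bar>t\<bar> \<le> d \<Longrightarrow> c t \<in> cball x r \<Longrightarrow> norm (c' t) \<le> M"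
    and M: "0 \<le> M" "d * M < r/2" and c0: "dist x (c 0) \<le> r/2" and t: "\<bar>t\<bar> \<le> d"
  shows "c t \<in> ball x r"
proof (cases "t \<ge> 0")
  case True
  show ?thesis
    using M c0 t True by (intro curve_stays_in_ball_forward[where d = d and c' = c' and c = c and M = M]) (auto intro!: c c')
next
  case False
  have "(c \<circ> uminus) (- t) \<in> ball x r"
  proof (rule curve_stays_in_ball_forward[where d = d and c' = "\<lambda>s. - c' (- s)" and M = M])
    show "(c \<circ> uminus has_vector_derivative - c' (- s)) (at s)" if "0 \<le> s" "s \<le> d" for s
    proof -
      have "(uminus has_vector_derivative (-1::real)) (at s)" by (auto intro!: derivative_eq_intros)
      from vector_diff_chain_at[OF this, of c] c[of "-s"] that show ?thesis by simp
    qed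
  qed (use c' t False c0 M in auto)
  then show ?thesis by simp
qed

text \<open>The contraction principle in the space of bounded continuous functions on the whole line, where the
  time argument is clamped to \<open>[-d, d]\<close>. The integral starts at \<open>-d\<close> and its value at \<open>0\<close> is subtracted,
  which treats positive and negative times alike and costs a factor \<open>2\<close>, so that the contraction
  constant is \<open>4 d M\<close>.\<close>

lemma picard_short_time:
  fixes F :: "real \<Rightarrow> 'b::euclidean_space \<Rightarrow> 'b"
  assumes d: "0 < d" and cont: "continuous_on ({-d..d} \<times> UNIV) (\<lambda>(t, y). F t y)"
    and lip: "\<And>t. t \<in> {-d..d} \<Longrightarrow> M-lipschitz_on UNIV (F t)" and dM: "6 * d * M \<le> 1"
  obtains w where "w 0 = y0" "\<And>t. \<bar>t\<bar> < d \<Longrightarrow> (w has_vector_derivative F t (w t)) (at t)"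
proof -
  define cl where "cl t = max (-d) (min d t)" for t :: real
  have cl: "cl t \<in> {-d..d}" for t unfolding cl_def using d by auto
  have cl_id: "cl t = t" if "t \<in> {-d..d}" for t unfolding cl_def using that by auto
  have ccl: "continuous_on UNIV cl" unfolding cl_def by (intro continuous_intros)
  define I where "I w t = integral {-d..t} (\<lambda>s. F s (w s))" for w t
  have cF: "continuous_on {-d..d} (\<lambda>s. F s (w s))" if "continuous_on {-d..d} w" for w
  proof -
    have "continuous_on {-d..d} (\<lambda>s. (\<lambda>(t, y). F t y) (s, w s))"
      by (rule continuous_on_compose2[OF cont]) (auto intro!: continuous_intros that)
    then show ?thesis by simp
  qed
  have intg: "(\<lambda>s. F s (w s)) integrable_on {-d..t}" if "continuous_on {-d..d} w" "t \<in> {-d..d}" for w t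
    by (rule integrable_continuous_real, rule continuous_on_subset[OF cF[OF that(1)]]) (use that in auto)
  have cI: "continuous_on {-d..d} (I w)" if "continuous_on {-d..d} w" for w
    unfolding I_def by (rule indefinite_integral_continuous_1[OF intg[OF that]]) (use d in auto)
  have cw: "continuous_on {-d..d} (apply_bcontfun w)" for w :: "real \<Rightarrow>\<^sub>C 'b"
    using continuous_on_apply_bcontfun by (rule continuous_on_subset) auto
  define \<Phi> where "\<Phi> w t = y0 + I (apply_bcontfun w) (cl t) - I (apply_bcontfun w) 0" for w :: "real \<Rightarrow>\<^sub>C 'b" and t
  have \<Phi>b: "\<Phi> w \<in> bcontfun" for w
  proof -
    have "continuous_on UNIV (\<lambda>t. I (apply_bcontfun w) (cl t))"
      by (rule continuous_on_compose2[OF cI[OF cw] ccl]) (use cl in auto)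
    then have 1: "continuous_on UNIV (\<Phi> w)" unfolding \<Phi>_def by (intro continuous_intros)
    have "compact (I (apply_bcontfun w) ` {-d..d})"
      by (intro compact_continuous_image cI[OF cw] compact_Icc)
    then have "bounded ((\<lambda>z. (y0 - I (apply_bcontfun w) 0) + z) ` I (apply_bcontfun w) ` {-d..d})"
      by (intro bounded_translation compact_imp_bounded)
    then have "bounded (range (\<Phi> w))"
    proof (rule bounded_subset, intro image_subsetI)
      fix t
      have "\<Phi> w t = (y0 - I (apply_bcontfun w) 0) + I (apply_bcontfun w) (cl t)" unfolding \<Phi>_def by simp
      then show "\<Phi> w t \<in> (\<lambda>z. (y0 - I (apply_bcontfun w) 0) + z) ` I (apply_bcontfun w) ` {-d..d}"
        using cl[of t] by blast
    qed
    then show ?thesis using 1 by (simp add: bcontfun_def)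
  qed
  have Idiff: "norm (I (apply_bcontfun w) t - I (apply_bcontfun z) t) \<le> M * dist w z * (2 * d)"
    if t: "t \<in> {-d..d}" for w z t
  proof -
    have "I (apply_bcontfun w) t - I (apply_bcontfun z) t = integral {-d..t} (\<lambda>s. F s (w s) - F s (z s))"
      unfolding I_def using t by (intro integral_diff[symmetric] intg cw)
    also have "norm \<dots> \<le> M * dist w z * (t - (-d))"
    proof (rule integral_bound)
      show "continuous_on {-d..t} (\<lambda>s. F s (w s) - F s (z s))"
        by (intro continuous_on_diff continuous_on_subset[OF cF[OF cw]]) (use t in auto)
      show "norm (F s (w s) - F s (z s)) \<le> M * dist w z" if s: "s \<in> {-d..t}" for s
      proof -
        have s': "s \<in> {-d..d}" using s t by auto
        have "norm (F s (w s) - F s (z s)) \<le> M * dist (w s) (z s)"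
          using lipschitz_onD[OF lip[OF s'], of "w s" "z s"] by (simp add: dist_norm)
        also have "\<dots> \<le> M * dist w z"
          using lipschitz_on_nonneg[OF lip[OF s']] by (intro mult_left_mono dist_bounded)
        finally show ?thesis .
      qed
    qed (use t in auto)
    also have "\<dots> \<le> M * dist w z * (2 * d)"
      using t lipschitz_on_nonneg[OF lip[OF t]] by (intro mult_left_mono) auto
    finally show ?thesis .
  qed
  have d0: "0 \<in> {-d..d}" using d by auto
  have M: "M \<ge> 0" using lipschitz_on_nonneg[OF lip[OF d0]] .
  have "\<exists>!w. Bcontfun (\<Phi> w) = w"
  proof (rule banach_fix_type[where c = "4 * d * M"])
    have "0 \<le> d * M" using M d by simp
    then show "4 * d * M < 1" using dM by linarith
    show "\<forall>w z. dist (Bcontfun (\<Phi> w)) (Bcontfun (\<Phi> z)) \<le> 4 * d * M * dist w z"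
    proof (intro allI dist_bound)
      fix w z t
      have "dist (Bcontfun (\<Phi> w) t) (Bcontfun (\<Phi> z) t) = dist (\<Phi> w t) (\<Phi> z t)"
        by (simp add: Bcontfun_inverse \<Phi>b)
      also have "\<dots> = norm ((I (apply_bcontfun w) (cl t) - I (apply_bcontfun z) (cl t)) - (I (apply_bcontfun w) 0 - I (apply_bcontfun z) 0))"
        unfolding \<Phi>_def dist_norm by (simp add: algebra_simps)
      also have "\<dots> \<le> M * dist w z * (2 * d) + M * dist w z * (2 * d)"
        by (rule order_trans[OF norm_triangle_ineq4 add_mono[OF Idiff[OF cl] Idiff[OF d0]]])
      finally show "dist (Bcontfun (\<Phi> w) t) (Bcontfun (\<Phi> z) t) \<le> 4 * d * M * dist w z"
        by (simp add: mult_ac)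
    qed
  qed (use M d in auto)
  then obtain w where "Bcontfun (\<Phi> w) = w" by blast
  then have w: "apply_bcontfun w t = \<Phi> w t" for t by (metis Bcontfun_inverse \<Phi>b)
  show thesis
  proof
    show "apply_bcontfun w 0 = y0" unfolding w[of 0] \<Phi>_def using cl_id[OF d0] by simp
    show "(apply_bcontfun w has_vector_derivative F t (apply_bcontfun w t)) (at t)" if t: "\<bar>t\<bar> < d" for t
    proof -
      have tin: "t \<in> {-d<..<d}" using t by auto
      have "(I (apply_bcontfun w) has_vector_derivative F t (apply_bcontfun w t)) (at t within {-d..d})"
        unfolding I_def using tin by (intro integral_has_vector_derivative cF cw) auto
      then have "(I (apply_bcontfun w) has_vector_derivative F t (apply_bcontfun w t)) (at t within {-d<..<d})"
        by (rule has_vector_derivative_within_subset) auto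
      then have I: "(I (apply_bcontfun w) has_vector_derivative F t (apply_bcontfun w t)) (at t)"
        unfolding at_within_open[OF tin open_greaterThanLessThan] .
      have D: "((\<lambda>t. (y0 - I (apply_bcontfun w) 0) + I (apply_bcontfun w) t) has_vector_derivative F t (apply_bcontfun w t)) (at t)"
        using has_vector_derivative_add[OF has_vector_derivative_const I] by simp
      show ?thesis
      proof (rule has_vector_derivative_transform_within_open[OF D open_greaterThanLessThan tin])
        show "(y0 - I (apply_bcontfun w) 0) + I (apply_bcontfun w) s = apply_bcontfun w s" if "s \<in> {-d<..<d}" for s
          unfolding w[of s] \<Phi>_def using cl_id[of s] that by simp
      qed
    qed
  qed
qed

section \<open>Matrix norms and the derivative of a determinant\<close>

lemma norm_matrix_vector_le:
  fixes A :: "real^'n^'m"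
  shows "norm (A *v h) \<le> norm A * norm h"
proof -
  have "norm (A *v h) = L2_set (\<lambda>i. norm ((A *v h) $ i)) UNIV" by (simp add: norm_vec_def)
  also have "\<dots> \<le> L2_set (\<lambda>i. norm (A $ i) * norm h) UNIV"
  proof (rule L2_set_mono)
    show "norm ((A *v h) $ i) \<le> norm (A $ i) * norm h" for i
      using Cauchy_Schwarz_ineq2[of "A $ i" h] by (simp add: matrix_mult_dot)
  qed auto
  also have "\<dots> = L2_set (\<lambda>i. norm (A $ i)) UNIV * norm h"
    by (rule L2_set_left_distrib[symmetric]) simp
  finally show ?thesis by (simp add: norm_vec_def)
qed

lemma norm_transpose:
  fixes A :: "real^'n^'m"
  shows "norm (transpose A) = norm A"
proof -
  have *: "norm B = sqrt (\<Sum>i\<in>UNIV. \<Sum>j\<in>UNIV. (B $ i $ j)\<^sup>2)" for B :: "real^'a^'b"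
    by (simp add: norm_vec_def L2_set_def sum_nonneg)
  show ?thesis unfolding * transpose_def by (subst sum.swap) simp
qed

lemma inner_transpose_matrix_vector:
  fixes A :: "real^'n^'m"
  shows "(transpose A *v y) \<bullet> h = y \<bullet> (A *v h)"
  by (simp add: dot_lmul_matrix)

lemma bounded_bilinear_matrix_vector_mult:
  "bounded_bilinear (\<lambda>(B::real^'n^'m) y. B *v y)"
proof
  show "\<exists>K. \<forall>(B::real^'n^'m) y. norm (B *v y) \<le> norm B * norm y * K"
    using norm_matrix_vector_le by (intro exI[of _ 1]) auto
qed (auto simp: matrix_vector_mult_add_rdistrib matrix_vector_right_distrib matrix_vector_mult_scaleR scaleR_matrix_vector_assoc)

text \<open>Jacobi's formula for a solution of \<open>J' = A J\<close>. The product rule gives a sum over \<open>k\<close> of determinants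
  of \<open>J\<close> with row \<open>k\<close> replaced by row \<open>k\<close> of \<open>A J\<close>. That row is a combination of the rows of \<open>J\<close>, and all
  its terms except \<open>A\<^sub>k\<^sub>k\<close> times row \<open>k\<close> produce determinants with two equal rows.\<close>

lemma det_has_derivative_linear_ode:
  fixes J :: "real \<Rightarrow> real^'n^'n"
  assumes J: "\<And>i j. ((\<lambda>s. J s $ i $ j) has_field_derivative (A ** J t) $ i $ j) (at t)"
  shows "((\<lambda>s. det (J s)) has_field_derivative (\<Sum>i\<in>UNIV. A $ i $ i) * det (J t)) (at t)"
proof -
  let ?P = "{p. p permutes (UNIV :: 'n set)}"
  let ?B = "A ** J t"
  let ?R = "\<lambda>k. \<chi> i. if i = k then ?B $ i else J t $ i"
  have rowB: "?B $ k = (\<Sum>l\<in>UNIV. A $ k $ l *s J t $ l)" for k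
    by (simp add: vec_eq_iff matrix_matrix_mult_def)
  have detR: "det (?R k) = A $ k $ k * det (J t)" for k
  proof -
    have "?R k = (\<chi> i. if i = k then (\<Sum>l\<in>UNIV. A $ k $ l *s J t $ l) else J t $ i)"
      by (simp add: vec_eq_iff rowB)
    then have "det (?R k) = (\<Sum>l\<in>UNIV. det (\<chi> i. if i = k then A $ k $ l *s J t $ l else J t $ i))"
      using det_linear_row_sum[of UNIV k "\<lambda>i l. A $ k $ l *s J t $ l" "\<lambda>i. J t $ i"] by simp
    also have "\<dots> = (\<Sum>l\<in>UNIV. A $ k $ l * det (\<chi> i. if i = k then J t $ l else J t $ i))"
      by (intro sum.cong refl det_row_mul)
    also have "\<dots> = (\<Sum>l\<in>UNIV. if l = k then A $ k $ k * det (J t) else 0)"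
    proof (intro sum.cong refl)
      fix l :: 'n
      show "A $ k $ l * det (\<chi> i. if i = k then J t $ l else J t $ i) = (if l = k then A $ k $ k * det (J t) else 0)"
      proof (cases "l = k")
        case True
        then have "(\<chi> i. if i = k then J t $ l else J t $ i) = J t" by (simp add: vec_eq_iff)
        then show ?thesis using True by simp
      next
        case False
        then have "det (\<chi> i. if i = k then J t $ l else J t $ i) = 0"
          by (intro det_identical_rows[of k l]) (auto simp: row_def vec_eq_iff)
        then show ?thesis using False by simp
      qed
    qed
    finally show ?thesis by simp
  qed
  have "((\<lambda>s. \<Sum>p\<in>?P. of_int (sign p) * (\<Prod>i\<in>UNIV. J s $ i $ p i)) has_field_derivative
     (\<Sum>p\<in>?P. of_int (sign p) * (\<Sum>k\<in>UNIV. ?B $ k $ p k * (\<Prod>i\<in>UNIV - {k}. J t $ i $ p i)))) (at t)"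
    by (intro DERIV_sum DERIV_cmult has_field_derivative_prod J)
  moreover have "(\<Sum>p\<in>?P. of_int (sign p) * (\<Sum>k\<in>UNIV. ?B $ k $ p k * (\<Prod>i\<in>UNIV - {k}. J t $ i $ p i)))
     = (\<Sum>k\<in>UNIV. det (?R k))"
  proof -
    have "?B $ k $ p k * (\<Prod>i\<in>UNIV - {k}. J t $ i $ p i) = (\<Prod>i\<in>UNIV. ?R k $ i $ p i)" for p k
      by (subst prod.remove[of UNIV k]) (auto intro!: prod.cong)
    then show ?thesis
      unfolding det_def sum_distrib_left by (subst sum.swap) simp
  qed
  ultimately show ?thesis unfolding detR det_def[of "J _"] by (simp add: sum_distrib_right)
qed

section \<open>The linearised flow\<close>

lemma C11_has_derivative:
  assumes "C11_on U v" "x \<in> U"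
  shows "(v has_derivative (\<lambda>h. jacobian v (at x) *v h)) (at x)"
  using assms unfolding C11_on_def by (simp add: jacobian_works)

lemma taylor_remainder_C11:
  fixes v :: "real^'n \<Rightarrow> real^'n"
  assumes v: "\<And>y. y \<in> S \<Longrightarrow> (v has_derivative (\<lambda>h. D y *v h)) (at y)"
    and D: "L-lipschitz_on S D" and S: "convex S" "a \<in> S" "b \<in> S"
  shows "norm (v b - v a - D a *v (b - a)) \<le> L * (norm (b - a))\<^sup>2"
proof -
  have L: "L \<ge> 0" using D lipschitz_on_nonneg by blast
  have seg: "closed_segment a b \<subseteq> S" using S by (simp add: closed_segment_subset)
  have "norm ((v b - D a *v b) - (v a - D a *v a)) \<le> (L * norm (b - a)) * norm (b - a)"
  proof (rule differentiable_bound[where S = "closed_segment a b" and f' = "\<lambda>z h. D z *v h - D a *v h"])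
    fix z assume z: "z \<in> closed_segment a b"
    have "((\<lambda>z. v z - D a *v z) has_derivative (\<lambda>h. D z *v h - D a *v h)) (at z)"
      by (intro has_derivative_diff v bounded_linear_imp_has_derivative matrix_vector_mul_bounded_linear) (use seg z in auto)
    then show "((\<lambda>z. v z - D a *v z) has_derivative (\<lambda>h. D z *v h - D a *v h)) (at z within closed_segment a b)"
      by (rule has_derivative_at_withinI)
    have "norm (D z - D a) \<le> L * norm (z - a)"
      using lipschitz_onD[OF D, of z a] seg z S by (auto simp: dist_norm)
    also have "\<dots> \<le> L * norm (b - a)"
      using L segment_bound(1)[OF z] by (intro mult_left_mono) (auto simp: norm_minus_commute)
    finally have Dz: "norm (D z - D a) \<le> L * norm (b - a)" .
    show "onorm (\<lambda>h. D z *v h - D a *v h) \<le> L * norm (b - a)"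
    proof (rule onorm_le)
      fix h
      have "norm (D z *v h - D a *v h) = norm ((D z - D a) *v h)" by (simp add: matrix_vector_mult_diff_rdistrib)
      also have "\<dots> \<le> norm (D z - D a) * norm h" by (rule norm_matrix_vector_le)
      also have "\<dots> \<le> L * norm (b - a) * norm h" using Dz by (rule mult_right_mono) simp
      finally show "norm (D z *v h - D a *v h) \<le> L * norm (b - a) * norm h" .
    qed
  qed auto
  then show ?thesis by (simp add: matrix_vector_mult_diff_distrib power2_eq_square algebra_simps)
qed

lemma linear_ode_short_time:
  fixes A :: "real \<Rightarrow> real^'n^'n"
  assumes d: "0 < d" and cont: "continuous_on {-d..d} A" and N: "\<And>t. t \<in> {-d..d} \<Longrightarrow> norm (A t) \<le> N"
    and dN: "6 * d * N \<le> 1"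
  obtains w where "w 0 = y0" "\<And>t. \<bar>t\<bar> < d \<Longrightarrow> (w has_vector_derivative A t *v w t) (at t)"
proof -
  have cont: "continuous_on ({-d..d} \<times> UNIV) (\<lambda>(t, y). A t *v y)"
    unfolding split_def
    by (intro bounded_bilinear.continuous_on[OF bounded_bilinear_matrix_vector_mult] continuous_on_compose2[OF cont] continuous_intros) auto
  have lip: "N-lipschitz_on UNIV (\<lambda>y. A t *v y)" if "t \<in> {-d..d}" for t
  proof (rule lipschitz_onI)
    fix y z
    have "norm (A t *v y - A t *v z) \<le> norm (A t) * norm (y - z)"
      unfolding matrix_vector_mult_diff_distrib[symmetric] by (rule norm_matrix_vector_le)
    also have "\<dots> \<le> N * norm (y - z)" using N[OF that] by (rule mult_right_mono) simp
    finally show "dist (A t *v y) (A t *v z) \<le> N * dist y z" by (simp add: dist_norm)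
  next
    show "0 \<le> N" using N[OF that] norm_ge_zero order_trans by blast
  qed
  show thesis by (rule picard_short_time[OF d cont lip dN, of y0]) (auto intro: that)
qed

text \<open>The columns of \<open>J\<close> solve the linearised equation. For \<open>y\<close> near \<open>x\<close> the error
  \<open>T\<^sub>t y - T\<^sub>t x - J\<^sub>t (y - x)\<close> solves it too, up to a remainder that is quadratic in \<open>T\<^sub>t y - T\<^sub>t x\<close> because
  \<open>Dv\<close> is Lipschitz. Two uses of \<open>short_time_bound\<close>, first for \<open>T\<^sub>t y - T\<^sub>t x\<close> and then for the error,
  bound the error by a multiple of \<open>\<bar>y - x\<bar>\<^sup>2\<close>. The bounds on \<open>A(t)\<close> and \<open>6 d N \<le> 1\<close> are recorded in the
  conclusion so that the adjoint equation can be solved on the same interval.\<close>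

lemma flow_jacobian_short_time:
  fixes v :: "real^'n \<Rightarrow> real^'n"
  assumes U: "open \<Omega>" "\<Omega> \<subseteq> U" and v: "C11_on U v"
    and flow: "is_flow U v \<Omega> \<epsilon> T" and eps: "\<epsilon> > 0" and x: "x \<in> \<Omega>"
  obtains d N J where "0 < d" "d < \<epsilon>" "6 * d * N \<le> 1"
    "continuous_on {-d..d} (\<lambda>t. jacobian v (at (T t x)))"
    "\<And>t. t \<in> {-d..d} \<Longrightarrow> norm (jacobian v (at (T t x))) \<le> N"
    "J 0 = mat 1"
    "\<And>t. \<bar>t\<bar> < d \<Longrightarrow> (T t has_derivative (\<lambda>h. J t *v h)) (at x)"
    "\<And>t h. \<bar>t\<bar> < d \<Longrightarrow>
       ((\<lambda>s. J s *v h) has_vector_derivative jacobian v (at (T t x)) *v (J t *v h)) (at t)"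
proof -
  define D where "D y = jacobian v (at y)" for y
  have vD: "(v has_derivative (\<lambda>h. D y *v h)) (at y)" if "y \<in> U" for y
    unfolding D_def by (rule C11_has_derivative[OF v that])
  obtain L where L: "L-lipschitz_on U D" using v unfolding C11_on_def D_def by blast
  have L0: "L \<ge> 0" using L lipschitz_on_nonneg by blast
  obtain r where r: "r > 0" "cball x r \<subseteq> \<Omega>" using U(1) x open_contains_cball by blast
  then have rU: "cball x r \<subseteq> U" using U(2) by blast
  define N where "N = norm (D x) + L * r"
  have N0: "N \<ge> 0" unfolding N_def using L0 r by simp
  have DN: "norm (D y) \<le> N" if y: "y \<in> cball x r" for y
  proof -
    have "norm (D y - D x) \<le> L * dist y x"
      using lipschitz_onD[OF L subsetD[OF rU y] subsetD[OF U(2) x]] by (simp only: dist_norm)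
    also have "\<dots> \<le> L * r" using y L0 by (intro mult_left_mono) (auto simp: dist_commute)
    finally show ?thesis unfolding N_def using norm_triangle_ineq2[of "D y" "D x"] by linarith
  qed
  have vlip: "norm (v a - v b) \<le> N * norm (a - b)" if "a \<in> cball x r" "b \<in> cball x r" for a b
  proof (rule differentiable_bound[where S = "cball x r" and f' = "\<lambda>y h. D y *v h"])
    show "(v has_derivative (\<lambda>h. D y *v h)) (at y within cball x r)" if "y \<in> cball x r" for y
      using vD that rU by (blast intro: has_derivative_at_withinI)
    show "onorm (\<lambda>h. D y *v h) \<le> N" if "y \<in> cball x r" for y
      using order_trans[OF norm_matrix_vector_le mult_right_mono[OF DN[OF that]]]
      by (intro onorm_le) simp
  qed (use that in auto)
  have "continuous_on (cball x r) v"
    using vD rU by (intro continuous_at_imp_continuous_on ballI has_derivative_continuous) blast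
  then have "bounded (v ` cball x r)" by (intro compact_imp_bounded compact_continuous_image compact_cball)
  then obtain M where M: "M > 0" "\<And>y. y \<in> cball x r \<Longrightarrow> norm (v y) \<le> M"
    unfolding bounded_pos by blast
  \<comment> \<open>In the time \<open>d\<close> a trajectory that starts in the ball of radius \<open>r/2\<close> cannot leave the ball of
    radius \<open>r\<close>, and both \<open>picard_short_time\<close> and \<open>short_time_bound\<close> apply with the constant \<open>N\<close>.\<close>
  define d where "d = min (\<epsilon> / 2) (min (r / (4 * M)) (1 / (6 * (N + 1))))"
  have d: "0 < d" "d < \<epsilon>" unfolding d_def using eps r(1) M(1) N0 by auto
  have "d \<le> r / (4 * M)" unfolding d_def by simp
  then have dM: "d * M < r / 2" using M(1) r(1) by (simp add: field_simps)
  have "d \<le> 1 / (6 * (N + 1))" unfolding d_def by simp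
  then have "d * (6 * (N + 1)) \<le> 1" using N0 by (simp add: field_simps)
  then have dN: "6 * d * N \<le> 1" using d by (simp add: algebra_simps)
  then have dN2: "d * N \<le> 1/2" by linarith
  have der: "((\<lambda>s. T s y) has_vector_derivative v (T t y)) (at t)" if "y \<in> \<Omega>" "\<bar>t\<bar> \<le> d" for y t
    using flow that d(2) unfolding is_flow_def by auto
  have T0: "T 0 y = y" if "y \<in> \<Omega>" for y using flow that unfolding is_flow_def by auto
  have stay: "T t y \<in> ball x r" if y: "dist x y \<le> r / 2" and t: "\<bar>t\<bar> \<le> d" for y t
  proof -
    have y\<Omega>: "y \<in> \<Omega>" using y r by (auto simp: subset_eq)
    show ?thesis
    proof (rule curve_stays_in_ball[where c = "\<lambda>s. T s y" and c' = "\<lambda>s. v (T s y)" and d = d and M = M])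
      show "dist x (T 0 y) \<le> r / 2" using y T0[OF y\<Omega>] by simp
    qed (use der[OF y\<Omega>] M dM t in auto)
  qed
  define A where "A t = D (T t x)" for t
  have Tx: "T t x \<in> cball x r" if "\<bar>t\<bar> \<le> d" for t
    using stay[of x t] that r(1) ball_subset_cball by auto
  have AN: "norm (A t) \<le> N" if "t \<in> {-d..d}" for t
    unfolding A_def using Tx[of t] that by (intro DN) auto
  have contA: "continuous_on {-d..d} A"
  proof -
    have "continuous_on {-d..d} (\<lambda>t. T t x)"
      by (intro continuous_at_imp_continuous_on ballI has_vector_derivative_continuous[OF der[OF x]]) auto
    moreover have "(\<lambda>t. T t x) ` {-d..d} \<subseteq> U"
    proof (rule image_subsetI)
      fix t assume "t \<in> {-d..d}"
      then have "\<bar>t\<bar> \<le> d" by auto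
      then show "T t x \<in> U" using Tx rU by blast
    qed
    ultimately show ?thesis unfolding A_def
      by (intro continuous_on_compose2[OF lipschitz_on_continuous_on[OF L]]) auto
  qed
  have "\<exists>w. w 0 = axis j (1::real) \<and> (\<forall>t. \<bar>t\<bar> < d \<longrightarrow> (w has_vector_derivative A t *v w t) (at t))" for j :: 'n
    by (rule linear_ode_short_time[OF d(1) contA AN dN, of "axis j 1"]) blast+
  then obtain w where w: "\<And>j. w j 0 = axis j (1::real)"
    "\<And>j t. \<bar>t\<bar> < d \<Longrightarrow> (w j has_vector_derivative A t *v w j t) (at t)" by metis
  define J where "J t = (\<chi> i j. w j t $ i)" for t
  have Jh: "J t *v h = (\<Sum>j\<in>UNIV. h $ j *\<^sub>R w j t)" for t h
    by (simp add: vec_eq_iff J_def matrix_vector_mult_def mult.commute)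
  have J0: "J 0 = mat 1"
    by (simp add: vec_eq_iff J_def w(1) mat_def axis_def)
  have Jder: "((\<lambda>s. J s *v h) has_vector_derivative A t *v (J t *v h)) (at t)" if t: "\<bar>t\<bar> < d" for t h
  proof -
    have "((\<lambda>s. \<Sum>j\<in>UNIV. h $ j *\<^sub>R w j s) has_vector_derivative (\<Sum>j\<in>UNIV. h $ j *\<^sub>R (A t *v w j t))) (at t)"
      by (intro has_vector_derivative_sum bounded_linear.has_vector_derivative[OF bounded_linear_scaleR_right] w(2)[OF t])
    moreover have "(\<Sum>j\<in>UNIV. h $ j *\<^sub>R (A t *v w j t)) = A t *v (\<Sum>j\<in>UNIV. h $ j *\<^sub>R w j t)"
      by (simp add: linear_sum[OF matrix_vector_mul_linear] matrix_vector_mult_scaleR)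
    ultimately show ?thesis unfolding Jh by simp
  qed
  have Tder: "(T t has_derivative (\<lambda>h. J t *v h)) (at x)" if t: "\<bar>t\<bar> < d" for t
  proof -
    have est: "norm (T t y - T t x - J t *v (y - x)) \<le> 8 * d * L * (norm (y - x))\<^sup>2" if y: "dist x y \<le> r / 2" for y
    proof -
      have y\<Omega>: "y \<in> \<Omega>" using y r by (auto simp: subset_eq)
      have tN: "\<bar>t\<bar> * N \<le> 1/2" using mult_right_mono[of "\<bar>t\<bar>" d N] t N0 dN2 by linarith
      have in_ball: "T s y \<in> cball x r" "T s x \<in> cball x r" if "\<bar>s\<bar> \<le> \<bar>t\<bar>" for s
        using stay[OF y, of s] Tx[of s] that t ball_subset_cball by auto
      have E1: "norm (T s y - T s x) \<le> 2 * norm (T 0 y - T 0 x) + 2 * \<bar>t\<bar> * 0" if s: "\<bar>s\<bar> \<le> \<bar>t\<bar>" for s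
      proof (rule short_time_bound[where f' = "\<lambda>s. v (T s y) - v (T s x)" and L = N])
        show "((\<lambda>s. T s y - T s x) has_vector_derivative v (T s y) - v (T s x)) (at s)" if "\<bar>s\<bar> \<le> \<bar>t\<bar>" for s
          using that t by (intro has_vector_derivative_diff der y\<Omega> x) auto
        show "norm (v (T s y) - v (T s x)) \<le> N * norm (T s y - T s x) + 0" if "\<bar>s\<bar> \<le> \<bar>t\<bar>" for s
          using vlip[OF in_ball[OF that]] by simp
      qed (use N0 tN s in auto)
      let ?E = "\<lambda>s. T s y - T s x - J s *v (y - x)"
      have "norm (?E t) \<le> 2 * norm (?E 0) + 2 * \<bar>t\<bar> * (L * (2 * norm (y - x))\<^sup>2)"
      proof (rule short_time_bound[where f' = "\<lambda>s. v (T s y) - v (T s x) - A s *v (J s *v (y - x))" and L = N])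
        show "(?E has_vector_derivative v (T s y) - v (T s x) - A s *v (J s *v (y - x))) (at s)" if "\<bar>s\<bar> \<le> \<bar>t\<bar>" for s
          using that t by (intro has_vector_derivative_diff der y\<Omega> x Jder) auto
        fix s assume s: "\<bar>s\<bar> \<le> \<bar>t\<bar>"
        let ?rem = "v (T s y) - v (T s x) - D (T s x) *v (T s y - T s x)"
        have "norm ?rem \<le> L * (norm (T s y - T s x))\<^sup>2"
          by (rule taylor_remainder_C11[where S = "cball x r"])
            (use vD rU in_ball[OF s] lipschitz_on_subset[OF L rU] in auto)
        also have "\<dots> \<le> L * (2 * norm (y - x))\<^sup>2"
          using E1[OF s] T0[OF y\<Omega>] T0[OF x] L0 by (intro mult_left_mono power_mono) auto
        finally have rem: "norm ?rem \<le> L * (2 * norm (y - x))\<^sup>2" .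
        have eq: "v (T s y) - v (T s x) - A s *v (J s *v (y - x)) = A s *v ?E s + ?rem"
          unfolding A_def by (simp add: matrix_vector_mult_diff_distrib)
        have AE: "norm (A s *v ?E s) \<le> N * norm (?E s)"
          using s t by (intro order_trans[OF norm_matrix_vector_le mult_right_mono[OF AN]]) (auto simp: abs_le_iff)
        show "norm (v (T s y) - v (T s x) - A s *v (J s *v (y - x))) \<le> N * norm (?E s) + L * (2 * norm (y - x))\<^sup>2"
          unfolding eq by (rule order_trans[OF norm_triangle_ineq add_mono[OF AE rem]])
      qed (use N0 tN L0 in auto)
      also have "?E 0 = 0" using T0[OF y\<Omega>] T0[OF x] J0 by simp
      finally have "norm (?E t) \<le> 8 * (\<bar>t\<bar> * (L * (norm (y - x))\<^sup>2))" by (simp add: power_mult_distrib)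
      also have "\<dots> \<le> 8 * (d * (L * (norm (y - x))\<^sup>2))"
        using t L0 by (intro mult_left_mono mult_right_mono) auto
      finally show ?thesis by (simp add: mult_ac)
    qed
    define c where "c = 8 * d * L + 1"
    have c: "c > 0" "8 * d * L \<le> c" unfolding c_def using d L0 by (auto simp: add_nonneg_pos)
    show ?thesis unfolding has_derivative_at_alt
    proof (intro conjI allI impI)
      fix e :: real assume e: "0 < e"
      let ?\<delta> = "min (r / 2) (e / c)"
      have "norm (T t y - T t x - J t *v (y - x)) \<le> e * norm (y - x)" if y: "norm (y - x) < ?\<delta>" for y
      proof -
        have "norm (T t y - T t x - J t *v (y - x)) \<le> 8 * d * L * (norm (y - x))\<^sup>2"
          using y by (intro est) (simp add: dist_norm norm_minus_commute)
        also have "\<dots> \<le> c * (norm (y - x))\<^sup>2" using c by (intro mult_right_mono) auto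
        also have "\<dots> = (c * norm (y - x)) * norm (y - x)" by (simp add: power2_eq_square)
        also have "\<dots> \<le> e * norm (y - x)"
        proof (rule mult_right_mono)
          have "norm (y - x) \<le> e / c" using y by simp
          then show "c * norm (y - x) \<le> e" using c by (simp add: field_simps)
        qed simp
        finally show ?thesis .
      qed
      moreover have "?\<delta> > 0" using r(1) e c by simp
      ultimately show "\<exists>\<delta>>0. \<forall>y. norm (y - x) < \<delta> \<longrightarrow> norm (T t y - T t x - J t *v (y - x)) \<le> e * norm (y - x)"
        by blast
    qed simp
  qed
  show thesis
    by (rule that[OF d dN _ _ J0 Tder, unfolded D_def[symmetric] A_def[symmetric]]) (use contA AN Jder in \<open>auto simp: A_def\<close>)
qed

section \<open>Derivatives of the transported coefficients\<close>

lemma constant_if_vector_derivative_zero: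
  fixes f :: "real \<Rightarrow> 'b::real_normed_vector"
  assumes "\<And>s. \<bar>s\<bar> < d \<Longrightarrow> (f has_vector_derivative 0) (at s)" and t: "\<bar>t\<bar> < d"
  shows "f t = f 0"
proof -
  have "norm (f t - f 0) \<le> 0 * \<bar>t - 0\<bar>"
  proof (rule vector_derivative_norm_bound[where f' = "\<lambda>_. 0"])
    show "(f has_vector_derivative 0) (at s)" if "s \<in> closed_segment 0 t" for s
      using that t by (intro assms) (auto simp: closed_segment_eq_real_ivl split: if_splits)
  qed simp
  then show ?thesis by simp
qed

text \<open>If \<open>p' = - A\<^sup>T p\<close> and \<open>w' = A w\<close>, then \<open>p \<bullet> w\<close> is constant. Taking \<open>w = J h\<close> for every \<open>h\<close> gives
  \<open>J\<^sup>T p = g\<close>, which identifies \<open>p\<close> with \<open>J\<^sup>-\<^sup>T g\<close>, since \<open>det J = 1\<close>.\<close>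

lemma flow_coefficients:
  fixes v :: "real^'n \<Rightarrow> real^'n"
  assumes U: "open \<Omega>" "\<Omega> \<subseteq> U" and v: "C11_on U v"
    and flow: "is_flow U v \<Omega> \<epsilon> T" and eps: "\<epsilon> > 0" and x: "x \<in> \<Omega>"
    and div: "\<And>y. y \<in> U \<Longrightarrow> divergence v y = 0"
  obtains d p where "0 < d" "d < \<epsilon>" "p 0 = g"
    "\<And>t. \<bar>t\<bar> < d \<Longrightarrow> (p has_vector_derivative - (transpose (jacobian v (at (T t x))) *v p t)) (at t)"
    "\<And>t. \<bar>t\<bar> < d \<Longrightarrow> a_coeff T t x = 1"
    "\<And>t. \<bar>t\<bar> < d \<Longrightarrow> qform (Q_coeff T t x) g g = p t \<bullet> p t"
proof (rule flow_jacobian_short_time[OF U v flow eps x])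
  fix d N J
  assume d: "0 < d" "d < \<epsilon>" and dN: "6 * d * N \<le> 1"
    and cont: "continuous_on {-d..d} (\<lambda>t. jacobian v (at (T t x)))"
    and N: "\<And>t. t \<in> {-d..d} \<Longrightarrow> norm (jacobian v (at (T t x))) \<le> N"
    and J0: "J 0 = mat 1"
    and TJ: "\<And>t. \<bar>t\<bar> < d \<Longrightarrow> (T t has_derivative (\<lambda>h. J t *v h)) (at x)"
    and J': "\<And>t h. \<bar>t\<bar> < d \<Longrightarrow>
       ((\<lambda>s. J s *v h) has_vector_derivative jacobian v (at (T t x)) *v (J t *v h)) (at t)"
  define A where "A t = jacobian v (at (T t x))" for t
  have jac: "jacobian (T t) (at x) = J t" if "\<bar>t\<bar> < d" for t
    unfolding jacobian_def frechet_derivative_at[OF TJ[OF that], symmetric] by simp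
  have tr: "(\<Sum>i\<in>UNIV. A t $ i $ i) = 0" if "\<bar>t\<bar> < d" for t
  proof -
    have "T t x \<in> U" using flow x that d(2) unfolding is_flow_def by auto
    then show ?thesis using div unfolding divergence_def A_def by blast
  qed
  have entry: "((\<lambda>s. J s $ i $ j) has_field_derivative (A t ** J t) $ i $ j) (at t)" if "\<bar>t\<bar> < d" for t i j
  proof -
    have "((\<lambda>s. (J s *v axis j 1) $ i) has_vector_derivative (A t *v (J t *v axis j 1)) $ i) (at t)"
      using bounded_linear.has_vector_derivative[OF bounded_linear_vec_nth J'[OF that]] unfolding A_def .
    moreover have "(A t *v (J t *v axis j 1)) $ i = (A t ** J t) $ i $ j"
      by (simp add: matrix_vector_mul_assoc matrix_vector_mul_component inner_axis flip: row_def)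
    moreover have "(J s *v axis j 1) $ i = J s $ i $ j" for s
      by (simp add: matrix_vector_mul_component inner_axis)
    ultimately show ?thesis by (simp add: has_real_derivative_iff_has_vector_derivative)
  qed
  have det1: "det (J t) = 1" if t: "\<bar>t\<bar> < d" for t
  proof -
    have "((\<lambda>s. det (J s)) has_vector_derivative 0) (at s)" if "\<bar>s\<bar> < d" for s
      using det_has_derivative_linear_ode[of J "A s" s, OF entry[OF that]] tr[OF that]
      by (simp add: has_real_derivative_iff_has_vector_derivative)
    from constant_if_vector_derivative_zero[OF this t] show ?thesis by (simp add: J0)
  qed
  have contA: "continuous_on {-d..d} (\<lambda>t. - transpose (A t))"
  proof -
    have "linear (transpose :: real^'n^'n \<Rightarrow> real^'n^'n)"
      by (rule linearI) (simp_all add: transpose_def vec_eq_iff)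
    then show ?thesis unfolding A_def
      by (intro continuous_intros linear_continuous_on_compose[OF cont])
  qed
  have NA: "norm (- transpose (A t)) \<le> N" if "t \<in> {-d..d}" for t
    using N[OF that] unfolding A_def by (simp add: norm_transpose)
  obtain p where p: "p 0 = g" "\<And>t. \<bar>t\<bar> < d \<Longrightarrow> (p has_vector_derivative (- transpose (A t)) *v p t) (at t)"
    by (rule linear_ode_short_time[OF d(1) contA NA dN, of g]) blast+
  have p': "(p has_vector_derivative - (transpose (A t) *v p t)) (at t)" if "\<bar>t\<bar> < d" for t
    using p(2)[OF that] unfolding bounded_bilinear.minus_left[OF bounded_bilinear_matrix_vector_mult] .
  have JTp: "transpose (J t) *v p t = g" if t: "\<bar>t\<bar> < d" for t
  proof -
    have "(transpose (J t) *v p t) \<bullet> h = g \<bullet> h" for h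
    proof -
      have "((\<lambda>s. p s \<bullet> (J s *v h)) has_vector_derivative 0) (at s)" if s: "\<bar>s\<bar> < d" for s
      proof -
        have "((\<lambda>s. p s \<bullet> (J s *v h)) has_vector_derivative
            (p s \<bullet> (A s *v (J s *v h)) + (- (transpose (A s) *v p s)) \<bullet> (J s *v h))) (at s)"
          using bounded_bilinear.has_vector_derivative[OF bounded_bilinear_inner p'[OF s] J'[OF s]]
          unfolding A_def .
        then show ?thesis unfolding inner_minus_left inner_transpose_matrix_vector by simp
      qed
      from constant_if_vector_derivative_zero[OF this t]
      show ?thesis unfolding inner_transpose_matrix_vector by (simp add: J0 p(1))
    qed
    then show ?thesis using vector_eq_rdot by blast
  qed
  show thesis
  proof (rule that[of d p, OF d p(1)])
    fix t assume t: "\<bar>t\<bar> < d"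
    show "(p has_vector_derivative - (transpose (jacobian v (at (T t x))) *v p t)) (at t)"
      using p'[OF t] unfolding A_def .
    show "a_coeff T t x = 1" unfolding a_coeff_def jac[OF t] by (rule det1[OF t])
    have inv: "invertible (J t)" using det1[OF t] by (simp add: invertible_det_nz)
    let ?K = "matrix_inv (J t)"
    have "transpose ?K *v g = transpose ?K *v (transpose (J t) *v p t)" by (simp only: JTp[OF t])
    also have "\<dots> = transpose (J t ** ?K) *v p t" by (simp only: matrix_vector_mul_assoc matrix_transpose_mul)
    also have "J t ** ?K = mat 1"
      using inv unfolding invertible_def matrix_inv_def by (rule someI_ex[THEN conjunct1])
    finally have Kg: "transpose ?K *v g = p t" by (simp only: transpose_mat matrix_vector_mul_lid)
    have "qform (Q_coeff T t x) g g = g \<bullet> (?K *v (transpose ?K *v g))"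
      unfolding qform_def Q_coeff_def jac[OF t] by (simp only: matrix_vector_mul_assoc)
    also have "\<dots> = (transpose ?K *v g) \<bullet> (transpose ?K *v g)"
      by (simp only: inner_transpose_matrix_vector)
    finally show "qform (Q_coeff T t x) g g = p t \<bullet> p t" unfolding Kg .
  qed
qed

lemma deriv_eq_local:
  fixes f g g' :: "real \<Rightarrow> real"
  assumes d: "0 < d" and fg: "\<And>t. \<bar>t\<bar> < d \<Longrightarrow> f t = g t"
    and g: "\<And>t. \<bar>t\<bar> < d \<Longrightarrow> (g has_field_derivative g' t) (at t)"
  shows "deriv f 0 = g' 0"
    and "(g' has_field_derivative c) (at 0) \<Longrightarrow> (deriv ^^ 2) f 0 = c"
proof -
  have f': "deriv f t = g' t" if t: "\<bar>t\<bar> < d" for t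
  proof (rule DERIV_imp_deriv, rule has_field_derivative_transform_within_open[OF g[OF t]])
    show "g s = f s" if "s \<in> {-d<..<d}" for s using that by (intro fg[symmetric]) auto
  qed (use t in auto)
  then show "deriv f 0 = g' 0" using d by simp
  assume "(g' has_field_derivative c) (at 0)"
  then have "(deriv f has_field_derivative c) (at 0)"
    by (rule has_field_derivative_transform_within_open[where S = "{-d<..<d}"]) (use d in \<open>auto simp: f'\<close>)
  then show "(deriv ^^ 2) f 0 = c" by (simp add: numeral_2_eq_2 DERIV_imp_deriv)
qed

lemma advection_eq: "advection v y = jacobian v (at y) *v v y"
  by (simp add: advection_def vec_eq_iff matrix_vector_mult_def mult.commute)

text \<open>The product rule gives \<open>DR h = Dv (Dv h) + H(h) v\<close>, and symmetry of second derivatives turns \<open>H(h) v\<close>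
  into \<open>H(v) h\<close>.\<close>

lemma jacobian_advection:
  fixes v :: "real^'n \<Rightarrow> real^'n"
  assumes U: "open U" "x \<in> U" and v: "C11_on U v"
    and H: "((\<lambda>y. jacobian v (at y)) has_derivative H) (at x)"
  shows "jacobian (advection v) (at x) = jacobian v (at x) ** jacobian v (at x) + H (v x)"
proof -
  define D where "D y = jacobian v (at y)" for y
  have vD: "(v has_derivative (\<lambda>h. D y *v h)) (at y)" if "y \<in> U" for y
    unfolding D_def by (rule C11_has_derivative[OF v that])
  have sym: "H k *v h = H h *v k" for h k
  proof -
    have "(H k *v h) $ i = (H h *v k) $ i" for i
    proof (rule symmetric_second_derivative[OF U, where f = "\<lambda>y. v y $ i" and G = "\<lambda>y h. (D y *v h) $ i" and H = "\<lambda>h k. (H k *v h) $ i"])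
      show "((\<lambda>y. v y $ i) has_derivative (\<lambda>h. (D y *v h) $ i)) (at y)" if "y \<in> U" for y
        by (rule bounded_linear.has_derivative[OF bounded_linear_vec_nth vD[OF that]])
      show "((\<lambda>y. (D y *v h) $ i) has_derivative (\<lambda>k. (H k *v h) $ i)) (at x)" for h
        by (rule bounded_linear.has_derivative[OF bounded_linear_vec_nth
              bounded_linear.has_derivative[OF bounded_bilinear.bounded_linear_left[OF bounded_bilinear_matrix_vector_mult] H[folded D_def]]])
    qed
    then show ?thesis by (simp add: vec_eq_iff)
  qed
  have "((\<lambda>y. D y *v v y) has_derivative (\<lambda>h. D x *v (D x *v h) + H h *v v x)) (at x)"
    by (rule bounded_bilinear.FDERIV[OF bounded_bilinear_matrix_vector_mult H[folded D_def] vD[OF U(2)]])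
  moreover have "(\<lambda>h. D x *v (D x *v h) + H h *v v x) = (\<lambda>h. (D x ** D x + H (v x)) *v h)"
    by (simp add: fun_eq_iff sym[of _ "v x"] matrix_vector_mul_assoc matrix_vector_mult_add_rdistrib)
  ultimately have "(advection v has_derivative (\<lambda>h. (D x ** D x + H (v x)) *v h)) (at x)"
    unfolding advection_eq[abs_def] D_def by simp
  from frechet_derivative_at[OF this] show ?thesis
    unfolding jacobian_def[of "advection v"] D_def[symmetric] by (metis matrix_of_matrix_vector_mul)
qed

text \<open>With \<open>A = Dv(T\<^sub>t x)\<close>, \<open>E = A'(0)\<close> and \<open>p' = - A\<^sup>T p\<close>, the function \<open>\<bar>p\<bar>\<^sup>2\<close> has first derivative
  \<open>- 2 (A p) \<bullet> p\<close>, and at \<open>0\<close>, with \<open>D = A(0)\<close>, second derivative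
  \<open>2 (D D g) \<bullet> g + 2 (D D\<^sup>T g) \<bullet> g - 2 (E g) \<bullet> g\<close>.\<close>

lemma flow_integrand_derivatives:
  fixes v :: "real^'n \<Rightarrow> real^'n"
  assumes U: "open \<Omega>" "open U" "\<Omega> \<subseteq> U" and v: "C11_on U v"
    and flow: "is_flow U v \<Omega> \<epsilon> T" and eps: "\<epsilon> > 0" and x: "x \<in> \<Omega>"
    and div: "\<And>y. y \<in> U \<Longrightarrow> divergence v y = 0"
  shows "deriv (\<lambda>t. a_coeff T t x) 0 = 0"
    and "(deriv ^^ 2) (\<lambda>t. a_coeff T t x) 0 = 0"
    and "deriv (\<lambda>t. qform (Q_coeff T t x) g g * a_coeff T t x) 0
      = - qform (transpose (jacobian v (at x)) + jacobian v (at x)) g g"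
    and "(\<lambda>y. jacobian v (at y)) differentiable (at x) \<Longrightarrow>
      (deriv ^^ 2) (\<lambda>t. qform (Q_coeff T t x) g g * a_coeff T t x) 0
      = (let DS = jacobian v (at x); DR = jacobian (advection v) (at x)
         in qform (transpose (2 *\<^sub>R (DS ** DS) - DR) + (2 *\<^sub>R (DS ** DS) - DR)
              + 2 *\<^sub>R (DS ** transpose DS)) g g)"
proof -
  obtain d p where d: "0 < d" "d < \<epsilon>" and p0: "p 0 = g"
    and p': "\<And>t. \<bar>t\<bar> < d \<Longrightarrow> (p has_vector_derivative - (transpose (jacobian v (at (T t x))) *v p t)) (at t)"
    and a1: "\<And>t. \<bar>t\<bar> < d \<Longrightarrow> a_coeff T t x = 1"
    and Q: "\<And>t. \<bar>t\<bar> < d \<Longrightarrow> qform (Q_coeff T t x) g g = p t \<bullet> p t"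
    using flow_coefficients[OF U(1,3) v flow eps x div, of g] by metis
  define A where "A t = jacobian v (at (T t x))" for t
  have T0: "T 0 x = x" using flow x unfolding is_flow_def by blast
  then have A0: "A 0 = jacobian v (at x)" unfolding A_def by simp
  show "deriv (\<lambda>t. a_coeff T t x) 0 = 0"
    by (rule deriv_eq_local(1)[OF d(1) a1]) auto
  show "(deriv ^^ 2) (\<lambda>t. a_coeff T t x) 0 = 0"
    by (rule deriv_eq_local(2)[OF d(1) a1, where g' = "\<lambda>_. 0"]) auto
  let ?q = "\<lambda>t. qform (Q_coeff T t x) g g * a_coeff T t x"
  let ?q' = "\<lambda>t. - 2 * ((A t *v p t) \<bullet> p t)"
  have q: "?q t = p t \<bullet> p t" if "\<bar>t\<bar> < d" for t using Q[OF that] a1[OF that] by simp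
  have q': "((\<lambda>t. p t \<bullet> p t) has_field_derivative ?q' t) (at t)" if t: "\<bar>t\<bar> < d" for t
  proof -
    have "((\<lambda>t. p t \<bullet> p t) has_vector_derivative
        (p t \<bullet> (- (transpose (A t) *v p t)) + (- (transpose (A t) *v p t)) \<bullet> p t)) (at t)"
      using bounded_bilinear.has_vector_derivative[OF bounded_bilinear_inner p'[OF t] p'[OF t]] unfolding A_def .
    moreover have "p t \<bullet> (- (transpose (A t) *v p t)) + (- (transpose (A t) *v p t)) \<bullet> p t = ?q' t"
      unfolding inner_commute[of "p t" "- _"] inner_minus_left inner_transpose_matrix_vector
      by (simp add: inner_commute)
    ultimately show ?thesis unfolding has_real_derivative_iff_has_vector_derivative by simp
  qed
  have "deriv ?q 0 = ?q' 0" by (rule deriv_eq_local(1)[OF d(1) q q'])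
  also have "\<dots> = - qform (transpose (A 0) + A 0) g g"
  proof -
    have "g \<bullet> (transpose (A 0) *v g) = (A 0 *v g) \<bullet> g"
      unfolding inner_commute[of g] inner_transpose_matrix_vector by (rule refl)
    then show ?thesis unfolding p0 qform_def matrix_vector_mult_add_rdistrib inner_add_right
      by (simp only: inner_commute[of g "A 0 *v g"])
  qed
  finally show "deriv ?q 0 = - qform (transpose (jacobian v (at x)) + jacobian v (at x)) g g"
    unfolding A0 .
  assume "(\<lambda>y. jacobian v (at y)) differentiable (at x)"
  then obtain H where H: "((\<lambda>y. jacobian v (at y)) has_derivative H) (at x)"
    unfolding differentiable_def by blast
  define E where "E = H (v x)"
  define D where "D = jacobian v (at x)"
  have DR: "jacobian (advection v) (at x) = D ** D + E"
    unfolding D_def E_def using x U(3) by (intro jacobian_advection[OF U(2) _ v H]) blast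
  have "((\<lambda>s. T s x) has_vector_derivative v x) (at 0)"
    using flow x eps T0 unfolding is_flow_def by (metis abs_zero)
  then have "(A has_vector_derivative E) (at 0)"
    using has_derivative_compose[of "\<lambda>s. T s x" "\<lambda>h. h *\<^sub>R v x" 0 UNIV "\<lambda>y. jacobian v (at y)" H] H
    unfolding has_vector_derivative_def A_def T0 E_def
    by (simp add: linear_cmul[OF has_derivative_linear[OF H]])
  then have "((\<lambda>t. A t *v p t) has_vector_derivative A 0 *v (- (transpose (A 0) *v p 0)) + E *v p 0) (at 0)"
    using p'[of 0] d(1) unfolding A_def[symmetric]
    by (intro bounded_bilinear.has_vector_derivative[OF bounded_bilinear_matrix_vector_mult]) auto
  then have "((\<lambda>t. (A t *v p t) \<bullet> p t) has_vector_derivative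
      (A 0 *v p 0) \<bullet> (- (transpose (A 0) *v p 0)) + (A 0 *v (- (transpose (A 0) *v p 0)) + E *v p 0) \<bullet> p 0) (at 0)"
    using p'[of 0] d(1) unfolding A_def[symmetric]
    by (intro bounded_bilinear.has_vector_derivative[OF bounded_bilinear_inner]) auto
  then have "(?q' has_field_derivative
      - 2 * ((D *v g) \<bullet> (- (transpose D *v g)) + (D *v (- (transpose D *v g)) + E *v g) \<bullet> g)) (at 0)"
    unfolding has_real_derivative_iff_has_vector_derivative[symmetric] A0 D_def[symmetric] p0
    by (rule DERIV_cmult)
  from deriv_eq_local(2)[OF d(1) q q' this]
  have "(deriv ^^ 2) ?q 0 = - 2 * ((D *v g) \<bullet> (- (transpose D *v g)) + (D *v (- (transpose D *v g)) + E *v g) \<bullet> g)" .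
  also have "\<dots> = 2 * ((D *v (D *v g)) \<bullet> g) + 2 * ((D *v (transpose D *v g)) \<bullet> g) - 2 * ((E *v g) \<bullet> g)"
  proof -
    have "(D *v g) \<bullet> (- (transpose D *v g)) = - ((D *v (D *v g)) \<bullet> g)"
      unfolding inner_minus_right inner_commute[of "D *v g"] inner_transpose_matrix_vector
      by (simp add: inner_commute)
    moreover have "D *v (- (transpose D *v g)) = - (D *v (transpose D *v g))"
      by (rule linear_neg[OF matrix_vector_mul_linear])
    ultimately show ?thesis by (simp add: inner_add_left inner_minus_left inner_diff_left)
  qed
  also have "\<dots> = qform (transpose (2 *\<^sub>R (D ** D) - (D ** D + E)) + (2 *\<^sub>R (D ** D) - (D ** D + E)) + 2 *\<^sub>R (D ** transpose D)) g g"
  proof -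
    let ?M = "2 *\<^sub>R (D ** D) - (D ** D + E)"
    have "?M = D ** D - E" by (simp add: scaleR_2)
    then have M: "?M *v g = D *v (D *v g) - E *v g"
      by (simp only: matrix_vector_mult_diff_rdistrib matrix_vector_mul_assoc)
    have t: "g \<bullet> (transpose ?M *v g) = g \<bullet> (?M *v g)"
      unfolding inner_commute[of g "transpose ?M *v g"] inner_transpose_matrix_vector ..
    have s: "(2 *\<^sub>R (D ** transpose D)) *v g = 2 *\<^sub>R (D *v (transpose D *v g))"
      by (simp only: scaleR_matrix_vector_assoc[symmetric] matrix_vector_mul_assoc)
    show ?thesis
      unfolding qform_def matrix_vector_mult_add_rdistrib inner_add_right t M s inner_scaleR_right inner_diff_right
      by (simp add: inner_commute[of g])
  qed
  finally show "(deriv ^^ 2) ?q 0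
      = (let DS = jacobian v (at x); DR = jacobian (advection v) (at x)
         in qform (transpose (2 *\<^sub>R (DS ** DS) - DR) + (2 *\<^sub>R (DS ** DS) - DR)
              + 2 *\<^sub>R (DS ** transpose DS)) g g)"
    unfolding DR D_def[symmetric] Let_def .
qed

text \<open>Lebesgue measure is complete. So if one of two almost everywhere equal functions is measurable, so is the
  other, and if neither is, both integrals have the default value \<open>0\<close>.\<close>

lemma integral_lebesgue_cong_AE:
  fixes f g :: "'a::euclidean_space \<Rightarrow> real"
  assumes ae: "AE x in lebesgue. f x = g x"
  shows "integral\<^sup>L lebesgue f = integral\<^sup>L lebesgue g"
proof -
  have meas: "g \<in> borel_measurable lebesgue" if f: "f \<in> borel_measurable lebesgue" and ae: "AE x in lebesgue. f x = g x"
    for f g :: "'a \<Rightarrow> real"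
  proof (rule measurableI)
    fix B :: "real set" assume B: "B \<in> sets borel"
    have "g -` B \<in> sets lebesgue"
    proof (rule completion.in_sets_AE[of "f -` B"])
      show "AE x in lebesgue. x \<in> f -` B \<longleftrightarrow> x \<in> g -` B" using ae by eventually_elim auto
      show "f -` B \<in> sets lebesgue" using measurable_sets[OF f B] by simp
    qed auto
    then show "g -` B \<inter> space lebesgue \<in> sets lebesgue" by simp
  qed auto
  have ae': "AE x in lebesgue. g x = f x" using ae by eventually_elim auto
  show ?thesis
  proof (cases "f \<in> borel_measurable lebesgue")
    case True
    then show ?thesis using meas[OF True ae] ae by (intro integral_cong_AE)
  next
    case False
    then have "g \<notin> borel_measurable lebesgue" using meas[OF _ ae'] by blast
    then have "\<not> integrable lebesgue f" "\<not> integrable lebesgue g"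
      using False borel_measurable_integrable by blast+
    then show ?thesis by (simp add: not_integrable_integral_eq)
  qed
qed

theorem theorem5:
  fixes \<Omega> \<gamma>0 \<gamma>1 U :: "(real^'n) set"
    and v S R :: "real^'n \<Rightarrow> real^'n"
    and T :: "real \<Rightarrow> real^'n \<Rightarrow> real^'n"
    and \<epsilon> :: real
    and lam :: "nat \<Rightarrow> real"
    and u :: "nat \<Rightarrow> real^'n \<Rightarrow> real"
    and k :: nat
    and \<phi> :: "real^'n \<Rightarrow> real"
  assumes "CARD('n) \<ge> 2"
    and "bounded_lipschitz_domain \<Omega>"
    and "openin (top_of_set (frontier \<Omega>)) \<gamma>0"
    and "openin (top_of_set (frontier \<Omega>)) \<gamma>1"
    and "\<gamma>0 \<inter> \<gamma>1 = {}"
    and "closure \<gamma>0 \<union> closure \<gamma>1 = frontier \<Omega>"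
    and "closure \<gamma>0 \<inter> closure \<gamma>1 = {}"
    and "open U" and "closure \<Omega> \<subseteq> U"
    and "C11_on U v"
    and "\<epsilon> > 0" and "is_flow U v \<Omega> \<epsilon> T"
    and "S = v" and "R = advection v"
    and "eigensystem \<Omega> \<gamma>0 T 0 lam u"
    and "k \<ge> 1"
    and "k \<ge> 2 \<longrightarrow> lam (k - 1) < lam k"
    and "lam k < lam (k + 1)"
    and "\<phi> = u k"
    and "\<forall>x\<in>U. divergence v x = 0"
  shows "B_dot0 \<Omega> T \<phi> \<phi> = 0
    \<and> B_ddot0 \<Omega> T \<phi> \<phi> = 0
    \<and> A_dot0 \<Omega> T \<phi> \<phi> =
        - (LINT x|lebesgue_on \<Omega>.
             (let DS = jacobian S (at x)
              in qform (transpose DS + DS) (weak_grad \<Omega> \<phi> x) (weak_grad \<Omega> \<phi> x)))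
    \<and> A_ddot0 \<Omega> T \<phi> \<phi> =
        (LINT x|lebesgue_on \<Omega>.
             (let DS = jacobian S (at x); DR = jacobian R (at x)
              in qform (transpose (2 *\<^sub>R (DS ** DS) - DR) + (2 *\<^sub>R (DS ** DS) - DR)
                          + 2 *\<^sub>R (DS ** transpose DS))
                   (weak_grad \<Omega> \<phi> x) (weak_grad \<Omega> \<phi> x)))"
proof -
  have \<Omega>: "open \<Omega>" using assms(2) unfolding bounded_lipschitz_domain_def by blast
  have \<Omega>U: "\<Omega> \<subseteq> U" using assms(9) closure_subset by blast
  note D = flow_integrand_derivatives[OF \<Omega> \<open>open U\<close> \<Omega>U \<open>C11_on U v\<close> \<open>is_flow U v \<Omega> \<epsilon> T\<close> \<open>\<epsilon> > 0\<close>
      _ bspec[OF \<open>\<forall>x\<in>U. divergence v x = 0\<close>]]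
  have "B_dot0 \<Omega> T \<phi> \<phi> = (LINT x|lebesgue_on \<Omega>. 0)"
    unfolding B_dot0_def by (rule Bochner_Integration.integral_cong) (auto simp: D(1))
  moreover have "B_ddot0 \<Omega> T \<phi> \<phi> = (LINT x|lebesgue_on \<Omega>. 0)"
    unfolding B_ddot0_def by (rule Bochner_Integration.integral_cong) (auto simp: D(2))
  moreover have "A_dot0 \<Omega> T \<phi> \<phi> = (LINT x|lebesgue_on \<Omega>. - qform (transpose (jacobian v (at x)) + jacobian v (at x))
      (weak_grad \<Omega> \<phi> x) (weak_grad \<Omega> \<phi> x))"
    unfolding A_dot0_def A_integrand_def by (rule Bochner_Integration.integral_cong) (auto intro!: D(3))
  moreover have "A_ddot0 \<Omega> T \<phi> \<phi> =
        (LINT x|lebesgue_on \<Omega>.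
             (let DS = jacobian v (at x); DR = jacobian (advection v) (at x)
              in qform (transpose (2 *\<^sub>R (DS ** DS) - DR) + (2 *\<^sub>R (DS ** DS) - DR)
                          + 2 *\<^sub>R (DS ** transpose DS))
                   (weak_grad \<Omega> \<phi> x) (weak_grad \<Omega> \<phi> x)))"
  proof -
    obtain L where L: "L-lipschitz_on U (\<lambda>x. jacobian v (at x))"
      using \<open>C11_on U v\<close> unfolding C11_on_def by blast
    have "AE x in lebesgue. x \<in> U \<longrightarrow> (\<lambda>y. jacobian v (at y)) differentiable (at x)"
      by (rule AE_completion[OF rademacher[OF L \<open>open U\<close>]])
    then have "AE x in lebesgue. indicator \<Omega> x *\<^sub>R (deriv ^^ 2) (\<lambda>t. A_integrand \<Omega> T \<phi> \<phi> t x) 0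
        = indicator \<Omega> x *\<^sub>R
            (let DS = jacobian v (at x); DR = jacobian (advection v) (at x)
              in qform (transpose (2 *\<^sub>R (DS ** DS) - DR) + (2 *\<^sub>R (DS ** DS) - DR)
                          + 2 *\<^sub>R (DS ** transpose DS))
                   (weak_grad \<Omega> \<phi> x) (weak_grad \<Omega> \<phi> x))"
    proof eventually_elim
      case (elim x)
      show ?case
      proof (cases "x \<in> \<Omega>")
        case True
        then have "(\<lambda>y. jacobian v (at y)) differentiable (at x)" using elim \<Omega>U by blast
        from D(4)[OF True _ this] show ?thesis unfolding A_integrand_def by simp
      qed simp
    qed
    note eq = integral_lebesgue_cong_AE[OF this]
    have "\<Omega> \<inter> space lebesgue \<in> sets lebesgue" using \<Omega> by simp
    from eq show ?thesis
      unfolding A_ddot0_def integral_restrict_space[OF \<open>\<Omega> \<inter> space lebesgue \<in> sets lebesgue\<close>] .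
  qed
  ultimately show ?thesis
    unfolding \<open>S = v\<close> \<open>R = advection v\<close> by (simp add: Let_def)
qed

end
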